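(* Under the standing setting, if $f_0=f_\infty=\infty$, then there exist $\lambda^*\in(0,\infty)$ and $m^*\in(0,\infty)$ such that: for every $\lambda\in(0,\lambda^* )$ problem (P$_\lambda$) has two positive solutions $u_1(\lambda),u_2(\lambda)$ with $0<\|u_1(\lambda)\|_\infty<m^*<\|u_2(\lambda)\|_\infty$, which can be chosen so that $\lim_{\lambda\to0^+}\|u_1(\lambda)\|_\infty=0$ and $\lim_{\lambda\to0^+}\|u_2(\lambda)\|_\infty=\infty$; and problem (P$_{\lambda^*}$) has a positive solution.
   Context: Standing setting. $\varphi:\mathbb{R}\to\mathbb{R}$ is an odd, increasing homeomorphism satisfying condition (A): there exist increasing homeomorphisms $\psi_1,\psi_2:[0,\infty)\to[0,\infty)$ such that $\varphi(x)\psi_1(y)\le \varphi(xy)\le \varphi(x)\psi_2(y)$ for all $x,y\ge 0$. Let $c,d\in C([0,1],(0,\infty))$, and $\|\cdot\|_\infty$ the maximum norm on $C[0,1]$. Let $f\in C([0,\infty),[0,\infty))$ with $f(s)>0$ for $s>0$, and write $f_0=\lim_{s\to0^+}f(s)/\varphi(s)$, $f_\infty=\lim_{s\to\infty}f(s)/\varphi(s)$ (assumed to exist in $[0,\infty]$ whenever referred to). Let $h\in C((0,1),[0,\infty))$, $h\not\equiv 0$, with $\int_0^{1/2}\psi_1^{-1}\big(\int_s^{1/2}h(\tau)d\tau\big)ds+\int_{1/2}^1\psi_1^{-1}\big(\int_{1/2}^s h(\tau)d\tau\big)ds<\infty$. Notation attached to $h$: $\alpha_h=\sup\{x\in(0,1):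 h=0 \text{ on }(0,x)\}$ ($0$ if empty); $\beta_h=\inf\{x\in(0,1): h=0\text{ on }(x,1)\}$ ($1$ if empty); $\bar\alpha_h=\sup\{x\in(\alpha_h,1]: h>0 \text{ on }(\alpha_h,x)\}$; $\bar\beta_h=\inf\{x\in[0,\beta_h): h>0\text{ on }(x,\beta_h)\}$; $\gamma_h^1=(3\alpha_h+\bar\alpha_h)/4$, $\gamma_h^2=(\bar\beta_h+3\beta_h)/4$. It is assumed that $0\le\alpha_h<\gamma_h^1<\gamma_h^2<\beta_h\le 1$. For $\lambda\ge0$, problem (P$_\lambda$) is: $(d(t)\varphi(c(t)u'(t)))'+\lambda h(t)f(u(t))=0$ for $t\in(0,1)$, $u(0)=u(1)=0$. A solution is $u\in C[0,1]\cap C^1(0,1)$ such that $t\mapsto d(t)\varphi(c(t)u'(t))$ is continuously differentiable on $(0,1)$ and the equation and boundary conditions hold; it is positive if $u(t)>0$ for all $t\in(0,1)$. *)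

theory Defs
  imports "HOL-Analysis.Analysis"
begin

definition odd_inc_homeo :: "(real \<Rightarrow> real) \<Rightarrow> bool" where
  "odd_inc_homeo \<phi> \<longleftrightarrow> (\<exists>g. homeomorphism UNIV UNIV \<phi> g) \<and> strict_mono \<phi> \<and> (\<forall>x. \<phi> (-x) = - \<phi> x)"

definition inc_homeo_nonneg :: "(real \<Rightarrow> real) \<Rightarrow> bool" where
  "inc_homeo_nonneg \<psi> \<longleftrightarrow> (\<exists>g. homeomorphism {0..} {0..} \<psi> g) \<and> strict_mono_on {0..} \<psi>"

definition condA :: "(real \<Rightarrow> real) \<Rightarrow> (real \<Rightarrow> real) \<Rightarrow> (real \<Rightarrow> real) \<Rightarrow> bool" where
  "condA \<phi> \<psi>1 \<psi>2 \<longleftrightarrow> inc_homeo_nonneg \<psi>1 \<and> inc_homeo_nonneg \<psi>2 \<and>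
     (\<forall>x\<ge>0. \<forall>y\<ge>0. \<phi> x * \<psi>1 y \<le> \<phi> (x * y) \<and> \<phi> (x * y) \<le> \<phi> x * \<psi>2 y)"

definition supnorm :: "(real \<Rightarrow> real) \<Rightarrow> real" where
  "supnorm u = Sup ((\<lambda>t. \<bar>u t\<bar>) ` {0..1})"

definition alpha_h :: "(real \<Rightarrow> real) \<Rightarrow> real" where
  "alpha_h h = (let S = {x\<in>{0<..<1}. \<forall>t\<in>{0<..<x}. h t = 0} in if S = {} then 0 else Sup S)"

definition beta_h :: "(real \<Rightarrow> real) \<Rightarrow> real" where
  "beta_h h = (let S = {x\<in>{0<..<1}. \<forall>t\<in>{x<..<1}. h t = 0} in if S = {} then 1 else Inf S)"

text \<open>If the defining set is empty, the quantity is set equal to alpha_h (resp. beta_h),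
  so that the standing assumption alpha_h < gamma_h^1 (resp. gamma_h^2 < beta_h) fails.\<close>
definition baralpha_h :: "(real \<Rightarrow> real) \<Rightarrow> real" where
  "baralpha_h h = (let a = alpha_h h; S = {x\<in>{a<..1}. \<forall>t\<in>{a<..<x}. h t > 0} in
      if S = {} then a else Sup S)"

definition barbeta_h :: "(real \<Rightarrow> real) \<Rightarrow> real" where
  "barbeta_h h = (let b = beta_h h; S = {x\<in>{0..<b}. \<forall>t\<in>{x<..<b}. h t > 0} in
      if S = {} then b else Inf S)"

definition gamma1_h :: "(real \<Rightarrow> real) \<Rightarrow> real" where
  "gamma1_h h = (3 * alpha_h h + baralpha_h h) / 4"

definition gamma2_h :: "(real \<Rightarrow> real) \<Rightarrow> real" where
  "gamma2_h h = (barbeta_h h + 3 * beta_h h) / 4"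

definition is_solution ::
  "(real \<Rightarrow> real) \<Rightarrow> (real \<Rightarrow> real) \<Rightarrow> (real \<Rightarrow> real) \<Rightarrow> (real \<Rightarrow> real) \<Rightarrow> (real \<Rightarrow> real)
    \<Rightarrow> real \<Rightarrow> (real \<Rightarrow> real) \<Rightarrow> bool" where
  "is_solution \<phi> c d h f lam u \<longleftrightarrow>
     continuous_on {0..1} u \<and> u 0 = 0 \<and> u 1 = 0 \<and>
     (\<exists>u'. (\<forall>t\<in>{0<..<1}. (u has_real_derivative u' t) (at t)) \<and> continuous_on {0<..<1} u' \<and>
        (\<exists>w'. (\<forall>t\<in>{0<..<1}. ((\<lambda>s. d s * \<phi> (c s * u' s)) has_real_derivative w' t) (at t)) \<and>
              continuous_on {0<..<1} w' \<and>
              (\<forall>t\<in>{0<..<1}. w' t + lam * h t * f (u t) = 0)))"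

definition is_pos_solution ::
  "(real \<Rightarrow> real) \<Rightarrow> (real \<Rightarrow> real) \<Rightarrow> (real \<Rightarrow> real) \<Rightarrow> (real \<Rightarrow> real) \<Rightarrow> (real \<Rightarrow> real)
    \<Rightarrow> real \<Rightarrow> (real \<Rightarrow> real) \<Rightarrow> bool" where
  "is_pos_solution \<phi> c d h f lam u \<longleftrightarrow> is_solution \<phi> c d h f lam u \<and> (\<forall>t\<in>{0<..<1}. u t > 0)"

end

theory Submission
  imports Defs "HOL-Complex_Analysis.Great_Picard"
begin

text \<open>
  Integrating the equation from a maximum point \<open>x\<close> of \<open>u\<close> in both directions turns the problem into
  a fixed point equation \<open>u = T u\<close>, where the two halves of \<open>T u\<close> are explicit monotone integrals that
  have to match at \<open>x\<close>. Condition (A) makes \<open>T u\<close> well defined for the possibly non-integrable \<open>h\<close>,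
  and monotonicity of the flux gives \<open>T u t \<ge> q * min t (1 - t) * supnorm (T u)\<close>.
  Comparing \<open>f\<close> with \<open>\<phi>\<close>, one finds \<open>supnorm (T u) \<ge> supnorm u\<close> whenever \<open>supnorm u\<close> is very small
  or very large, and \<open>supnorm (T u) \<le> r\<close> for \<open>supnorm u = r\<close> as long as \<open>lam \<le> bnd r\<close>, where \<open>bnd r > 0\<close>.
  So with \<open>m_star = 1\<close> and \<open>lam_star = bnd 1\<close> there is a compressive annulus inside and an expansive
  one outside the unit sphere, each containing a solution. Shrinking or enlarging the sphere shows
  that solutions of arbitrarily small and large norm exist for small \<open>lam\<close>.
  The fixed points come from a Schauder theorem for continuous functions with values in \<open>[0,1]\<close>,
  proved by interpolation from Brouwer's theorem for cubes.
\<close>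

section \<open>Fixed points of equicontinuous operators on functions into the unit interval\<close>

text \<open>The matching position \<open>x\<close> is not a continuous function of \<open>u\<close>:
  \<open>h\<close> may vanish on a subinterval, and then a whole interval of positions may match. So
  \<open>x\<close> is not solved for; it becomes an unknown of its own beside the norm, and equality
  of the two heights is one of the fixed point equations. A scalar unknown in [0,1] is updated by
  adding its defect and truncating. At a fixed point the defect is zero unless the unknown sits at
  an end with the defect pointing outwards, which the estimates exclude. Thus compression and
  expansion need only Schauder's theorem and no fixed point index.

  The second obstacle is that \<open>h\<close> may be non-integrable at 0 and 1. All limits and
  moduli therefore rest on one integrable majorant, which is uniform only while \<open>x\<close>
  stays away from the far end point. This is secured because a half with its maximum close to its
  own end point is too low to match the other one.

  \<open>bnd r\<close> is the upper estimate for the height solved for \<open>lam\<close>. At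
  \<open>lam = bnd 1\<close> it is only a weak inequality, so the solutions from the two annuli
  might coincide on the unit sphere.\<close>

lemma cube_fixed_point:
  fixes F :: "(nat \<Rightarrow> real) \<Rightarrow> nat \<Rightarrow> real" and n :: nat
  assumes range: "\<And>x i. \<forall>j<n. x j \<in> {0..1} \<Longrightarrow> i < n \<Longrightarrow> F x i \<in> {0..1}"
    and cont: "\<And>X Y i. \<forall>k. \<forall>j<n. X k j \<in> {0..1} \<Longrightarrow> \<forall>j<n. (\<lambda>k. X k j) \<longlonglongrightarrow> Y j \<Longrightarrow>
        i < n \<Longrightarrow> (\<lambda>k. F (X k) i) \<longlonglongrightarrow> F Y i"
  obtains y where "\<forall>j<n. y j \<in> {0..1}" "\<forall>i<n. F y i = y i"
proof -
  \<comment> \<open>The dimension is a number and not a type, so Kuhn's combinatorial lemma is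
    applied directly. In one small grid cell every coordinate \<open>i\<close> has a point
    \<open>r\<close> where \<open>F\<close> does not lower it and a point \<open>s\<close> where
    \<open>F\<close> does not raise it; refining the grid merges these points in the limit.\<close>
  have ex: "\<exists>z. (\<forall>j<n. z j \<in> {0..1}) \<and> (\<forall>i<n. \<exists>r s. 
      (\<forall>j<n. r j \<in> {0..1} \<and> \<bar>r j - z j\<bar> \<le> 1 / real (Suc p)) \<and>
      (\<forall>j<n. s j \<in> {0..1} \<and> \<bar>s j - z j\<bar> \<le> 1 / real (Suc p)) \<and> r i \<le> F r i \<and> F s i \<le> s i)" for p
  proof -
    define S where "S = (\<lambda>(x :: nat \<Rightarrow> nat) j. real (x j) / real (Suc p))"
    \<comment> \<open>Kuhn's lemma prescribes label 0 on the face \<open>x i = 0\<close> and label 1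
      on the opposite face. As \<open>F\<close> maps into the cube, the forced values agree with the
      sign of \<open>F (S x) i - S x i\<close>; this is what \<open>l0\<close> and \<open>l1\<close>
      record.\<close>
    define label :: "(nat \<Rightarrow> nat) \<Rightarrow> nat \<Rightarrow> nat" where
      "label x i = (if x i = 0 \<or> (x i \<noteq> Suc p \<and> S x i \<le> F (S x) i) then 0 else 1)" for x i
    have S01: "\<forall>j<n. S x j \<in> {0..1}" if "\<forall>j<n. x j \<le> Suc p" for x
      using that by (auto simp: S_def divide_simps)
    obtain q where q: "\<forall>i<n. q i < Suc p"
      and rs: "\<forall>i<n. \<exists>r s. (\<forall>j<n. q j \<le> r j \<and> r j \<le> q j + 1) \<and>
        (\<forall>j<n. q j \<le> s j \<and> s j \<le> q j + 1) \<and> label r i \<noteq> label s i"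
      by (rule kuhn_lemma[of "Suc p" n label]) (auto simp: label_def)
    have near: "\<forall>j<n. S r j \<in> {0..1} \<and> \<bar>S r j - S q j\<bar> \<le> 1 / real (Suc p)"
      if "\<forall>j<n. q j \<le> r j \<and> r j \<le> q j + 1" for r
    proof (intro allI impI conjI)
      fix j assume j: "j < n"
      have "\<forall>j<n. r j \<le> Suc p" using that q by (metis Suc_eq_plus1 Suc_leI le_trans add_le_cancel_right)
      then show "S r j \<in> {0..1}" using S01 j by blast
      have "\<bar>real (r j) - real (q j)\<bar> \<le> 1" using that[rule_format, OF j] by linarith
      then show "\<bar>S r j - S q j\<bar> \<le> 1 / real (Suc p)"
        unfolding S_def diff_divide_distrib[symmetric] by (simp add: divide_simps)
    qed
    have l0: "S r i \<le> F (S r) i" if "label r i = 0" "\<forall>j<n. S r j \<in> {0..1}" "i < n" for r i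
      using that range[of "S r" i] by (auto simp: label_def S_def split: if_splits)
    have l1: "F (S r) i \<le> S r i" if "label r i \<noteq> 0" "\<forall>j<n. S r j \<in> {0..1}" "i < n" for r i
      using that range[of "S r" i] by (auto simp: label_def S_def split: if_splits)
    show ?thesis
    proof (rule exI[of _ "S q"], intro conjI allI impI)
      fix j assume "j < n" then show "S q j \<in> {0..1}" using near[of q] by auto
    next
      fix i assume i: "i < n"
      obtain r s where r: "\<forall>j<n. q j \<le> r j \<and> r j \<le> q j + 1"
        and s: "\<forall>j<n. q j \<le> s j \<and> s j \<le> q j + 1" and l: "label r i \<noteq> label s i"
        using rs i by blast
      have "label r i = 0 \<and> label s i \<noteq> 0 \<or> label s i = 0 \<and> label r i \<noteq> 0"
        using l by (auto simp: label_def split: if_splits)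
      then show "\<exists>r s. (\<forall>j<n. r j \<in> {0..1} \<and> \<bar>r j - S q j\<bar> \<le> 1 / real (Suc p)) \<and>
        (\<forall>j<n. s j \<in> {0..1} \<and> \<bar>s j - S q j\<bar> \<le> 1 / real (Suc p)) \<and> r i \<le> F r i \<and> F s i \<le> s i"
      proof
        assume "label r i = 0 \<and> label s i \<noteq> 0"
        then show ?thesis using near[OF r] near[OF s] l0[of r i] l1[of s i] i
          by (intro exI[of _ "S r"] exI[of _ "S s"]) auto
      next
        assume "label s i = 0 \<and> label r i \<noteq> 0"
        then show ?thesis using near[OF r] near[OF s] l0[of s i] l1[of r i] i
          by (intro exI[of _ "S s"] exI[of _ "S r"]) auto
      qed
    qed
  qed
  then obtain Z where Z01: "\<And>p j. j < n \<Longrightarrow> Z p j \<in> {0..1}"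
    and Z: "\<And>p i. i < n \<Longrightarrow> \<exists>r s. (\<forall>j<n. r j \<in> {0..1} \<and> \<bar>r j - Z p j\<bar> \<le> 1 / real (Suc p)) \<and>
      (\<forall>j<n. s j \<in> {0..1} \<and> \<bar>s j - Z p j\<bar> \<le> 1 / real (Suc p)) \<and> r i \<le> F r i \<and> F s i \<le> s i"
    by metis
  define Q where "Q p i r s \<longleftrightarrow> (\<forall>j<n. r j \<in> {0..1} \<and> \<bar>r j - Z p j\<bar> \<le> 1 / real (Suc p)) \<and>
      (\<forall>j<n. s j \<in> {0..1} \<and> \<bar>s j - Z p j\<bar> \<le> 1 / real (Suc p)) \<and> r i \<le> F r i \<and> F s i \<le> s i"
    for p i r s
  define R where "R p i = (SOME r. \<exists>s. Q p i r s)" for p i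
  define T where "T p i = (SOME s. Q p i (R p i) s)" for p i
  have "\<exists>s. Q p i (R p i) s" if "i < n" for p i
    unfolding R_def using Z[OF that, of p]
    by (intro someI_ex[of "\<lambda>r. \<exists>s. Q p i r s"]) (simp add: Q_def)
  then have "Q p i (R p i) (T p i)" if "i < n" for p i
    unfolding T_def using that by (metis someI_ex)
  then have
      R: "\<And>p i j. i < n \<Longrightarrow> j < n \<Longrightarrow> R p i j \<in> {0..1} \<and> \<bar>R p i j - Z p j\<bar> \<le> 1 / real (Suc p)"
    and T: "\<And>p i j. i < n \<Longrightarrow> j < n \<Longrightarrow> T p i j \<in> {0..1} \<and> \<bar>T p i j - Z p j\<bar> \<le> 1 / real (Suc p)"
    and RT: "\<And>p i. i < n \<Longrightarrow> R p i i \<le> F (R p i) i \<and> F (T p i) i \<le> T p i i"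
    unfolding Q_def by blast+
  obtain k where k: "strict_mono (k :: nat \<Rightarrow> nat)"
    and "\<And>j. j \<in> {..<n} \<Longrightarrow> \<exists>l. (\<lambda>p. Z (k p) j) \<longlonglongrightarrow> l"
    by (rule function_convergent_subsequence[of "{..<n}" Z 1]) (use Z01 in auto)
  then obtain y where y: "\<And>j. j < n \<Longrightarrow> (\<lambda>p. Z (k p) j) \<longlonglongrightarrow> y j"
    by (metis lessThan_iff)
  have k0: "(\<lambda>p. 1 / real (Suc (k p))) \<longlonglongrightarrow> 0"
    using LIMSEQ_subseq_LIMSEQ[OF LIMSEQ_inverse_real_of_nat k] by (simp add: o_def inverse_eq_divide)
  have lim: "(\<lambda>p. X p) \<longlonglongrightarrow> y j" if "j < n" "\<And>p. \<bar>X p - Z (k p) j\<bar> \<le> 1 / real (Suc (k p))" for X j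
  proof -
    have "(\<lambda>p. X p - Z (k p) j) \<longlonglongrightarrow> 0"
      by (rule Lim_null_comparison[OF _ k0]) (use that in auto)
    from tendsto_add[OF this y[OF that(1)]] show ?thesis by simp
  qed
  have Fy: "F y i = y i" if i: "i < n" for i
  proof (rule antisym)
    have "(\<lambda>p. F (T (k p) i) i) \<longlonglongrightarrow> F y i"
      by (rule cont) (use T i lim in auto)
    moreover have "(\<lambda>p. T (k p) i i) \<longlonglongrightarrow> y i" by (rule lim) (use T i in auto)
    ultimately show "F y i \<le> y i" by (rule LIMSEQ_le) (use RT i in auto)
    have "(\<lambda>p. R (k p) i i) \<longlonglongrightarrow> y i" by (rule lim) (use R i in auto)
    moreover have "(\<lambda>p. F (R (k p) i) i) \<longlonglongrightarrow> F y i"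
      by (rule cont) (use R i lim in auto)
    ultimately show "y i \<le> F y i" by (rule LIMSEQ_le) (use RT i in auto)
  qed
  moreover have "\<forall>j<n. y j \<in> {0..1}"
    using y Z01 closed_sequentially[of "{0..1}"] by (metis closed_real_atLeastAtMost)
  ultimately show thesis using that by blast
qed

section \<open>Piecewise linear interpolation on a uniform grid\<close>

definition hat :: "nat \<Rightarrow> nat \<Rightarrow> real \<Rightarrow> real" where
  "hat N i t = max 0 (1 - \<bar>real N * t - real i\<bar>)"

text \<open>Dividing by the sum of the hats avoids having to know that this sum is 1.\<close>
definition interpol :: "nat \<Rightarrow> (nat \<Rightarrow> real) \<Rightarrow> real \<Rightarrow> real" where
  "interpol N x t = (\<Sum>i\<le>N. x i * hat N i t) / (\<Sum>i\<le>N. hat N i t)"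

lemma hat_nonneg: "0 \<le> hat N i t"
  by (simp add: hat_def)

lemma sum_hat_pos:
  assumes "t \<in> {0..1}"
  shows "0 < (\<Sum>i\<le>N. hat N i t)"
proof (rule sum_pos2)
  have "real N * t \<le> real N" using assms by (simp add: mult_left_le)
  then show "nat \<lfloor>real N * t\<rfloor> \<in> {..N}" by (simp add: nat_le_iff floor_le_iff)
  have "0 \<le> real N * t" using assms by simp
  then have "\<bar>real N * t - real (nat \<lfloor>real N * t\<rfloor>)\<bar> < 1" by linarith
  then show "0 < hat N (nat \<lfloor>real N * t\<rfloor>) t" by (simp add: hat_def)
qed (auto simp: hat_nonneg)

text \<open>The interpolant is a convex combination of nodal values, and only nodes less than one
  mesh width from \<open>t\<close> carry weight. This one estimate yields the range, the continuity
  in the nodal values and the approximation property.\<close>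

lemma interpol_near:
  assumes t: "t \<in> {0..1}" and near: "\<And>i. i \<le> N \<Longrightarrow> \<bar>real N * t - real i\<bar> < 1 \<Longrightarrow> \<bar>x i - y\<bar> \<le> e"
  shows "\<bar>interpol N x t - y\<bar> \<le> e"
proof -
  let ?S = "\<Sum>i\<le>N. hat N i t"
  have S: "0 < ?S" using sum_hat_pos t .
  have "interpol N x t - y = (\<Sum>i\<le>N. (x i - y) * hat N i t) / ?S"
    using S by (simp add: interpol_def divide_simps left_diff_distrib sum_subtractf sum_distrib_left)
  then have "\<bar>interpol N x t - y\<bar> = \<bar>\<Sum>i\<le>N. (x i - y) * hat N i t\<bar> / ?S"
    using S by simp
  also have "\<dots> \<le> (\<Sum>i\<le>N. e * hat N i t) / ?S"
  proof (intro divide_right_mono sum_abs[THEN order_trans] sum_mono)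
    fix i assume i: "i \<in> {..N}"
    show "\<bar>(x i - y) * hat N i t\<bar> \<le> e * hat N i t"
    proof (cases "\<bar>real N * t - real i\<bar> < 1")
      case True
      then show ?thesis using near[of i] i hat_nonneg[of N i t] by (simp add: abs_mult mult_right_mono)
    next
      case False
      then show ?thesis by (simp add: hat_def)
    qed
  qed (use S in simp)
  also have "\<dots> = e" using S by (simp add: sum_distrib_left[symmetric])
  finally show ?thesis .
qed

lemma continuous_on_interpol: "continuous_on {0..1} (interpol N x)"
  unfolding interpol_def
proof (intro continuous_intros)
  show "\<forall>t\<in>{0..1}. (\<Sum>i\<le>N. hat N i t) \<noteq> 0" using sum_hat_pos by (metis less_irrefl)
qed (auto simp: hat_def[abs_def] intro!: continuous_intros)

lemma interpol_range:
  assumes "t \<in> {0..1}" "\<And>i. i \<le> N \<Longrightarrow> x i \<in> {0..1}"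
  shows "interpol N x t \<in> {0..1}"
proof -
  \<comment> \<open>The unit interval is the ball of radius 1/2 about 1/2.\<close>
  have "\<bar>interpol N x t - 1/2\<bar> \<le> 1/2"
    by (rule interpol_near) (use assms in \<open>auto simp: abs_if\<close>)
  then show ?thesis unfolding atLeastAtMost_iff by linarith
qed

lemma uniform_limit_interpol:
  assumes "\<And>i. i \<le> N \<Longrightarrow> (\<lambda>k. X k i) \<longlonglongrightarrow> Y i"
  shows "uniform_limit {0..1} (\<lambda>k. interpol N (X k)) (interpol N Y) sequentially"
proof (rule uniform_limitI)
  fix e :: real assume e: "0 < e"
  have "\<forall>\<^sub>F k in sequentially. \<forall>i\<in>{..N}. dist (X k i) (Y i) < e / 2"
    by (rule eventually_ball_finite) (use assms e in \<open>auto simp del: less_divide_eq_numeral1 intro!: tendstoD\<close>)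
  then show "\<forall>\<^sub>F k in sequentially. \<forall>t\<in>{0..1}. dist (interpol N (X k) t) (interpol N Y t) < e"
  proof eventually_elim
    case (elim k)
    show ?case
    proof
      fix t :: real assume t: "t \<in> {0..1}"
      have "interpol N (X k) t - interpol N Y t = interpol N (\<lambda>i. X k i - Y i) t - 0"
        by (simp add: interpol_def diff_divide_distrib left_diff_distrib sum_subtractf)
      moreover have "\<bar>interpol N (\<lambda>i. X k i - Y i) t - 0\<bar> \<le> e / 2"
        by (rule interpol_near) (use t elim in \<open>auto simp: dist_real_def intro: less_imp_le\<close>)
      ultimately show "dist (interpol N (X k) t) (interpol N Y t) < e"
        using e by (simp add: dist_real_def)
    qed
  qed
qed

definition unit_fun :: "(real \<Rightarrow> real) \<Rightarrow> bool" where
  "unit_fun v \<longleftrightarrow> continuous_on {0..1} v \<and> (\<forall>t\<in>{0..1}. v t \<in> {0..1})"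

text \<open>Galerkin's method: \<open>v\<close> is replaced by the interpolant of finitely many
  nodal values, the resulting map of a cube has a fixed point, and the mesh is refined. Uniform
  equicontinuity of the images stands in for compactness, which is why pointwise convergence of
  \<open>V\<close> suffices in \<open>cont\<close>. The scalars \<open>A\<close> and
  \<open>B\<close> are carried along for the norm and the position of the maximum.\<close>

lemma schauder_unit_interval:
  fixes A B :: "real \<Rightarrow> real \<Rightarrow> (real \<Rightarrow> real) \<Rightarrow> real"
    and V :: "real \<Rightarrow> real \<Rightarrow> (real \<Rightarrow> real) \<Rightarrow> real \<Rightarrow> real"
  assumes range: "\<And>a b v. a \<in> {0..1} \<Longrightarrow> b \<in> {0..1} \<Longrightarrow> unit_fun v \<Longrightarrow>
      A a b v \<in> {0..1} \<and> B a b v \<in> {0..1} \<and> (\<forall>t\<in>{0..1}. V a b v t \<in> {0..1})"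
    and equi: "\<And>e. e > 0 \<Longrightarrow> \<exists>\<delta>>0. \<forall>a\<in>{0..1}. \<forall>b\<in>{0..1}. \<forall>v. unit_fun v \<longrightarrow>
      (\<forall>s\<in>{0..1}. \<forall>t\<in>{0..1}. \<bar>s - t\<bar> < \<delta> \<longrightarrow> \<bar>V a b v s - V a b v t\<bar> < e)"
    and cont: "\<And>an bn vn a b v. \<lbrakk>\<And>n. an n \<in> {0..1}; \<And>n. bn n \<in> {0..1}; \<And>n. unit_fun (vn n); 
        a \<in> {0..1}; b \<in> {0..1}; unit_fun v;
        an \<longlonglongrightarrow> a; bn \<longlonglongrightarrow> b; uniform_limit {0..1} vn v sequentially\<rbrakk> \<Longrightarrow>
        (\<lambda>n. A (an n) (bn n) (vn n)) \<longlonglongrightarrow> A a b v \<and> (\<lambda>n. B (an n) (bn n) (vn n)) \<longlonglongrightarrow> B a b v \<and>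
        (\<forall>t\<in>{0..1}. (\<lambda>n. V (an n) (bn n) (vn n) t) \<longlonglongrightarrow> V a b v t)"
  obtains a b v where "a \<in> {0..1}" "b \<in> {0..1}" "unit_fun v" "A a b v = a" "B a b v = b"
    "\<forall>t\<in>{0..1}. V a b v t = v t"
proof -
  have ex: "\<exists>a b y. a \<in> {0..1} \<and> b \<in> {0..1} \<and> (\<forall>i\<le>Suc N. y i \<in> {0..1}) \<and>
    A a b (interpol (Suc N) y) = a \<and> B a b (interpol (Suc N) y) = b \<and>
    (\<forall>i\<le>Suc N. V a b (interpol (Suc N) y) (real i / real (Suc N)) = y i)" for N
  proof -
    \<comment> \<open>Coordinates 0 and 1 hold the scalars and the other \<open>N + 2\<close> the
      values at the nodes \<open>i / Suc N\<close>, so the cube has dimension \<open>N + 4\<close>.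
      Using \<open>Suc N\<close> avoids a division by zero.\<close>
    define W where "W = (\<lambda>x. interpol (Suc N) (\<lambda>i. x (Suc (Suc i))))"
    define F where "F x i = (case i of 0 \<Rightarrow> A (x 0) (x 1) (W x) | Suc 0 \<Rightarrow> B (x 0) (x 1) (W x)
      | Suc (Suc i) \<Rightarrow> V (x 0) (x 1) (W x) (real i / real (Suc N)))" for x i
    have W: "unit_fun (W x)" if "\<forall>j<N+4. x j \<in> {0..1}" for x
      unfolding unit_fun_def W_def using that
      by (auto intro!: continuous_on_interpol interpol_range simp del: atLeastAtMost_iff)
    have F01: "F x i \<in> {0..1}" if "\<forall>j<N+4. x j \<in> {0..1}" "i < N+4" for x i
    proof -
      have *: "x 0 \<in> {0..1}" "x 1 \<in> {0..1}" using that by auto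
      have "real m / real (Suc N) \<in> {0..1}" if "i = Suc (Suc m)" for m
        using \<open>i < N+4\<close> that by simp
      then show ?thesis
        using range[OF * W[OF that(1)]]
        by (auto simp: F_def split: nat.splits simp del: atLeastAtMost_iff of_nat_Suc)
    qed
    have Fcont: "(\<lambda>k. F (X k) i) \<longlonglongrightarrow> F Y i" if X: "\<forall>k. \<forall>j<N+4. X k j \<in> {0..1}"
      and Y: "\<forall>j<N+4. (\<lambda>k. X k j) \<longlonglongrightarrow> Y j" and i: "i < N+4" for X Y i
    proof -
      have Y01: "\<forall>j<N+4. Y j \<in> {0..1}"
        using X Y closed_sequentially[of "{0..1}"] by (metis closed_real_atLeastAtMost)
      have "uniform_limit {0..1} (\<lambda>k. W (X k)) (W Y) sequentially"
        unfolding W_def by (rule uniform_limit_interpol) (use Y in auto)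
      moreover have "real m / real (Suc N) \<in> {0..1}" if "i = Suc (Suc m)" for m
        using i that by simp
      ultimately show ?thesis
        using cont[of "\<lambda>k. X k 0" "\<lambda>k. X k 1" "\<lambda>k. W (X k)" "Y 0" "Y 1" "W Y"] W X Y Y01 i
        by (auto simp: F_def split: nat.splits simp del: atLeastAtMost_iff of_nat_Suc)
    qed
    obtain y where y: "\<forall>j<N+4. y j \<in> {0..1}" "\<forall>i<N+4. F y i = y i"
      using cube_fixed_point[of "N+4" F] F01 Fcont by blast
    show ?thesis
    proof (intro exI conjI allI impI)
      show "y 0 \<in> {0..1}" "y 1 \<in> {0..1}" using y by auto
      show "A (y 0) (y 1) (interpol (Suc N) (\<lambda>i. y (Suc (Suc i)))) = y 0"
        using y(2)[rule_format, of 0] by (simp add: F_def W_def)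
      show "B (y 0) (y 1) (interpol (Suc N) (\<lambda>i. y (Suc (Suc i)))) = y 1"
        using y(2)[rule_format, of 1] by (simp add: F_def W_def)
      show "y (Suc (Suc i)) \<in> {0..1}" if "i \<le> Suc N" for i using y that by auto
      show "V (y 0) (y 1) (interpol (Suc N) (\<lambda>i. y (Suc (Suc i)))) (real i / real (Suc N)) = y (Suc (Suc i))"
        if "i \<le> Suc N" for i
        using y(2)[rule_format, of "Suc (Suc i)"] that by (simp add: F_def W_def)
    qed
  qed
  then obtain an bn yn where an: "\<And>N. an N \<in> {0..1}" and bn: "\<And>N. bn N \<in> {0..1}"
    and yn: "\<And>N i. i \<le> Suc N \<Longrightarrow> yn N i \<in> {0..1}"
    and fA: "\<And>N. A (an N) (bn N) (interpol (Suc N) (yn N)) = an N"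
    and fB: "\<And>N. B (an N) (bn N) (interpol (Suc N) (yn N)) = bn N"
    and fV: "\<And>N i. i \<le> Suc N \<Longrightarrow> V (an N) (bn N) (interpol (Suc N) (yn N)) (real i / real (Suc N)) = yn N i"
    by metis
  define vn where "vn N = interpol (Suc N) (yn N)" for N
  define Vn where "Vn N = V (an N) (bn N) (vn N)" for N
  have vn: "unit_fun (vn N)" for N
    unfolding unit_fun_def vn_def using yn
    by (auto intro!: continuous_on_interpol interpol_range simp del: atLeastAtMost_iff)
  have Vn01: "Vn N t \<in> {0..1}" if "t \<in> {0..1}" for N t
    unfolding Vn_def using range[OF an bn vn] that by blast
  \<comment> \<open>\<open>vn N\<close> interpolates the nodal values of its own image
    \<open>Vn N\<close>, so equicontinuity bounds their distance by the oscillation of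
    \<open>Vn N\<close> over one mesh width.\<close>
  have close: "\<forall>\<^sub>F N in sequentially. \<forall>t\<in>{0..1}. \<bar>vn N t - Vn N t\<bar> \<le> e" if e: "e > 0" for e
  proof -
    obtain \<delta> where \<delta>: "\<delta> > 0" and D: "\<And>N s t. s \<in> {0..1} \<Longrightarrow> t \<in> {0..1} \<Longrightarrow> \<bar>s - t\<bar> < \<delta> \<Longrightarrow> \<bar>Vn N s - Vn N t\<bar> < e"
      using equi[OF e] an bn vn unfolding Vn_def by metis
    have "\<forall>\<^sub>F N in sequentially. inverse (real (Suc N)) < \<delta>"
      using LIMSEQ_inverse_real_of_nat \<delta> by (rule order_tendstoD)
    then show ?thesis
    proof eventually_elim
      case (elim N)
      show ?case
      proof
        fix t :: real assume t: "t \<in> {0..1}"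
        show "\<bar>vn N t - Vn N t\<bar> \<le> e" unfolding vn_def
        proof (rule interpol_near[OF t])
          fix i assume i: "i \<le> Suc N" "\<bar>real (Suc N) * t - real i\<bar> < 1"
          have "t - real i / real (Suc N) = (real (Suc N) * t - real i) / real (Suc N)"
            by (simp add: field_simps)
          then have "\<bar>real i / real (Suc N) - t\<bar> = \<bar>real (Suc N) * t - real i\<bar> / real (Suc N)"
            by (metis abs_minus_commute abs_divide abs_of_nat)
          also have "\<dots> < 1 / real (Suc N)"
            by (rule divide_strict_right_mono) (use i in simp_all)
          also have "\<dots> < \<delta>" using elim by (simp add: inverse_eq_divide)
          finally have "\<bar>Vn N (real i / real (Suc N)) - Vn N t\<bar> < e"
            using i t by (intro D) auto
          then show "\<bar>yn N i - Vn N t\<bar> \<le> e"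
            using fV[OF i(1)] by (simp add: Vn_def vn_def)
        qed
      qed
    qed
  qed
  have "seq_compact ({0..1::real} \<times> {0..1::real})"
    by (simp add: compact_Times compact_imp_seq_compact)
  then obtain ab k1 where ab: "ab \<in> {0..1} \<times> {0..1}" and k1: "strict_mono (k1 :: nat \<Rightarrow> nat)"
    and abl: "((\<lambda>n. (an n, bn n)) \<circ> k1) \<longlonglongrightarrow> ab"
    using an bn by (metis (no_types, lifting) SigmaI seq_compactE)
  \<comment> \<open>Equicontinuity is known for the images, so the convergent subsequence is
    extracted from \<open>Vn\<close>; the interpolants follow by \<open>close\<close>.\<close>
  obtain v k2 where vc: "continuous_on {0..1::real} v" and k2: "strict_mono (k2 :: nat \<Rightarrow> nat)"
    and vl: "\<And>e. 0 < e \<Longrightarrow> \<exists>N. \<forall>n x. n \<ge> N \<and> x \<in> {0..1} \<longrightarrow> norm (Vn (k1 (k2 n)) x - v x) < e"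
  proof (rule Arzela_Ascoli[of "{0..1::real}" "\<lambda>n. Vn (k1 n)" 1])
    show "\<exists>d>0. \<forall>n y. y \<in> {0..1} \<and> norm (x - y) < d \<longrightarrow> norm (Vn (k1 n) x - Vn (k1 n) y) < e"
      if x: "x \<in> {0..1}" and e: "0 < e" for x e :: real
    proof -
      obtain \<delta> where "\<delta> > 0" "\<And>N s t. s \<in> {0..1} \<Longrightarrow> t \<in> {0..1} \<Longrightarrow> \<bar>s - t\<bar> < \<delta> \<Longrightarrow> \<bar>Vn N s - Vn N t\<bar> < e"
        using equi[OF e] an bn vn unfolding Vn_def by metis
      then show ?thesis using x by (intro exI[of _ \<delta>]) (auto simp del: atLeastAtMost_iff)
    qed
    show "norm (Vn (k1 n) x) \<le> 1" if "x \<in> {0..1}" for n x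
      using Vn01[OF that, of "k1 n"] by simp
  qed auto
  define k where "k = k1 \<circ> k2"
  have k: "strict_mono k" unfolding k_def using k1 k2 by (rule strict_mono_o)
  have ulV: "uniform_limit {0..1} (\<lambda>n. Vn (k n)) v sequentially"
    by (rule uniform_limitI) (use vl in \<open>auto simp: eventually_sequentially dist_real_def k_def simp del: atLeastAtMost_iff, blast\<close>)
  have ulv: "uniform_limit {0..1} (\<lambda>n. vn (k n)) v sequentially"
  proof (rule uniform_limitI)
    fix e :: real assume e: "e > 0"
    have "\<forall>\<^sub>F n in sequentially. \<forall>t\<in>{0..1}. \<bar>vn (k n) t - Vn (k n) t\<bar> \<le> e / 2"
      using eventually_subseq[OF k close[of "e/2"]] e by simp
    moreover have "\<forall>\<^sub>F n in sequentially. \<forall>t\<in>{0..1}. dist (Vn (k n) t) (v t) < e / 2"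
      using uniform_limitD[OF ulV, of "e/2"] e by simp
    ultimately show "\<forall>\<^sub>F n in sequentially. \<forall>t\<in>{0..1}. dist (vn (k n) t) (v t) < e"
    proof eventually_elim
      case (elim n)
      show ?case
      proof
        fix t :: real assume "t \<in> {0..1}"
        then have "\<bar>vn (k n) t - Vn (k n) t\<bar> \<le> e / 2" "\<bar>Vn (k n) t - v t\<bar> < e / 2"
          using elim by (auto simp: dist_real_def)
        then show "dist (vn (k n) t) (v t) < e" unfolding dist_real_def by linarith
      qed
    qed
  qed
  have Vpt: "(\<lambda>n. Vn (k n) t) \<longlonglongrightarrow> v t" if "t \<in> {0..1}" for t
    using tendsto_uniform_limitI[OF ulV that] .
  have v01: "unit_fun v"
    unfolding unit_fun_def using vc Vpt Vn01 closed_sequentially[of "{0..1}"] 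
    by (metis (no_types, lifting) closed_real_atLeastAtMost)
  obtain a b where ab': "ab = (a, b)" by (cases ab)
  have "((\<lambda>n. (an n, bn n)) \<circ> k) \<longlonglongrightarrow> ab"
    using LIMSEQ_subseq_LIMSEQ[OF abl k2] by (simp add: k_def o_assoc)
  then have al: "(\<lambda>n. an (k n)) \<longlonglongrightarrow> a" and bl: "(\<lambda>n. bn (k n)) \<longlonglongrightarrow> b"
    using tendsto_fst[of "\<lambda>n. (an (k n), bn (k n))" ab] tendsto_snd[of "\<lambda>n. (an (k n), bn (k n))" ab]
    by (auto simp: o_def ab')
  have a: "a \<in> {0..1}" and b: "b \<in> {0..1}" using ab ab' by auto
  have C: "(\<lambda>n. A (an (k n)) (bn (k n)) (vn (k n))) \<longlonglongrightarrow> A a b v \<and>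
      (\<lambda>n. B (an (k n)) (bn (k n)) (vn (k n))) \<longlonglongrightarrow> B a b v \<and>
        (\<forall>t\<in>{0..1}. (\<lambda>n. V (an (k n)) (bn (k n)) (vn (k n)) t) \<longlonglongrightarrow> V a b v t)"
    using cont[OF an bn vn a b v01 al bl ulv] .
  show thesis
  proof (rule that[OF a b v01])
    show "A a b v = a" using C al fA by (auto simp: vn_def intro: LIMSEQ_unique)
    show "B a b v = b" using C bl fB by (auto simp: vn_def intro: LIMSEQ_unique)
    show "\<forall>t\<in>{0..1}. V a b v t = v t" using C Vpt LIMSEQ_unique unfolding Vn_def by blast
  qed
qed

section \<open>Solutions on one side of the maximum\<close>

lemma integrable_on_compact_part:
  fixes k :: "real \<Rightarrow> real"
  assumes "continuous_on {0<..<1} k" "0 < s" "x < 1"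
  shows "k integrable_on {s..x}"
  by (rule integrable_continuous_real, rule continuous_on_subset[OF assms(1)]) (use assms in auto)

lemma continuous_on_integral_lower:
  fixes k :: "real \<Rightarrow> real"
  assumes k: "continuous_on {0<..<1} k" and x: "0 < x" "x < 1"
  shows "continuous_on {0<..<1} (\<lambda>s. integral {s..x} k)"
proof -
  have "continuous_on (\<Union>e\<in>{0<..<x}. {e<..<1}) (\<lambda>s. integral {s..x} k)"
  proof (rule continuous_on_open_UN)
    fix e assume e: "e \<in> {0<..<x}"
    have "continuous_on {e..x} (\<lambda>s. integral {s..x} k)"
      by (rule indefinite_integral_continuous_1') (use integrable_on_compact_part[OF k, of e x] e x in auto)
    \<comment> \<open>For \<open>s > x\<close> the interval is empty and the integral is 0;
      \<open>min s x\<close> extends the continuity across \<open>x\<close>.\<close>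
    then have "continuous_on {e<..<1} (\<lambda>s. integral {min s x..x} k)"
      by (rule continuous_on_compose2[of _ _ _ "\<lambda>s. min s x"]) (use e in \<open>auto intro!: continuous_intros\<close>)
    moreover have "integral {min s x..x} k = integral {s..x} k" for s
      by (cases "s \<le> x") auto
    ultimately show "continuous_on {e<..<1} (\<lambda>s. integral {s..x} k)" by simp
  qed auto
  moreover have "(\<Union>e\<in>{0<..<x}. {e<..<1}) = {0<..<1}"
  proof -
    have "\<exists>e\<in>{0<..<x}. s \<in> {e<..<1}" if "0 < s" "s < 1" for s
      by (rule bexI[of _ "min (s/2) (x/2)"]) (use that x in \<open>auto simp: min_def\<close>)
    then show ?thesis by fastforce
  qed
  ultimately show ?thesis by simp
qed

lemma continuous_on_integral_upper:
  fixes k :: "real \<Rightarrow> real"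
  assumes k: "continuous_on {0<..<1} k" and s: "0 < s" "s < 1"
  shows "continuous_on {0<..<1} (\<lambda>x. integral {s..x} k)"
proof -
  have "continuous_on (\<Union>b\<in>{s<..<1}. {0<..<b}) (\<lambda>x. integral {s..x} k)"
  proof (rule continuous_on_open_UN)
    fix b assume b: "b \<in> {s<..<1}"
    have "continuous_on {s..b} (\<lambda>x. integral {s..x} k)"
      by (rule indefinite_integral_continuous_1) (use integrable_on_compact_part[OF k, of s b] b s in auto)
    then have "continuous_on {0<..<b} (\<lambda>x. integral {s..max s x} k)"
      by (rule continuous_on_compose2[of _ _ _ "\<lambda>x. max s x"]) (use b in \<open>auto intro!: continuous_intros\<close>)
    moreover have "integral {s..max s x} k = integral {s..x} k" for x
      by (cases "s \<le> x") auto
    ultimately show "continuous_on {0<..<b} (\<lambda>x. integral {s..x} k)" by simp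
  qed auto
  moreover have "(\<Union>b\<in>{s<..<1}. {0<..<b}) = {0<..<1}"
  proof -
    have "\<exists>b\<in>{s<..<1}. x \<in> {0<..<b}" if "0 < x" "x < 1" for x
      by (rule bexI[of _ "(1 + max x s) / 2"]) (use that s in \<open>auto simp: max_def\<close>)
    then show ?thesis by fastforce
  qed
  ultimately show ?thesis by simp
qed

text \<open>\<open>G\<close> plays the role of the inverse of \<open>\<phi>\<close>. Condition (A) enters only through
  \<open>G_int\<close> and \<open>G_bd\<close>, which come from \<open>\<psi>1\<close>, and \<open>\<kappa>\<close>, which comes from \<open>\<psi>2\<close>.\<close>
locale half_operator =
  fixes G c d h :: "real \<Rightarrow> real" and c0 c1 d0 d1 \<kappa> Q :: real
  assumes G_mono: "strict_mono G" and G_cont: "continuous_on UNIV G" and G0 [simp]: "G 0 = 0"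
    and c_cont: "continuous_on {0..1} c" and c_bds: "\<And>t. t \<in> {0..1} \<Longrightarrow> c0 \<le> c t \<and> c t \<le> c1"
    and d_cont: "continuous_on {0..1} d" and d_bds: "\<And>t. t \<in> {0..1} \<Longrightarrow> d0 \<le> d t \<and> d t \<le> d1"
    and c0: "0 < c0" and d0: "0 < d0"
    and h_cont: "continuous_on {0<..<1} h" and h_nonneg: "\<And>t. t \<in> {0<..<1} \<Longrightarrow> 0 \<le> h t"
    and G_int: "\<And>K. 0 \<le> K \<Longrightarrow> (\<lambda>s. G (K * integral {s..1/2} h)) integrable_on {0<..1/2}"
    and G_bd: "\<And>K. 0 \<le> K \<Longrightarrow> integral {0<..1/2} (\<lambda>s. G (K * integral {s..1/2} h)) \<le> Q * G K"
    and \<kappa>: "0 < \<kappa>" "\<And>w. 0 \<le> w \<Longrightarrow> \<kappa> * G (w / d0) \<le> G (w / d1)"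
begin

lemma c1: "0 < c1" and d1: "0 < d1"
  using c_bds[of 0] d_bds[of 0] c0 d0 by auto

lemma G_le: "x \<le> y \<Longrightarrow> G x \<le> G y"
  using G_mono by (simp add: strict_mono_less_eq)

lemma G_nonneg: "0 \<le> x \<Longrightarrow> 0 \<le> G x"
  using G_le[of 0 x] by simp

text \<open>The derivative of the left half of \<open>T u\<close>: the flux vanishes at the maximum
  point \<open>x\<close>, hence equals \<open>integral {s..x} k\<close> at \<open>s\<close>. For
  \<open>s > x\<close> the interval is empty and the value is 0 without a case split. At the end
  points, where \<open>k\<close> may be singular, 0 is set by hand.\<close>

definition g :: "(real \<Rightarrow> real) \<Rightarrow> real \<Rightarrow> real \<Rightarrow> real" where
  "g k x s = (if 0 < s \<and> s < 1 then G (integral {s..x} k / d s) / c s else 0)"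

text \<open>Since \<open>g k x\<close> vanishes beyond \<open>x\<close>, the height of the half at
  its peak is \<open>L k x 1\<close>, evaluated at a point that does not move with
  \<open>x\<close>.\<close>

definition L :: "(real \<Rightarrow> real) \<Rightarrow> real \<Rightarrow> real \<Rightarrow> real" where
  "L k x t = integral {0..t} (g k x)"

text \<open>Domination by \<open>K * h\<close> is what makes integrability, equicontinuity and
  limits uniform over all weights coming from bounded \<open>u\<close>.\<close>

definition adm :: "real \<Rightarrow> (real \<Rightarrow> real) \<Rightarrow> bool" where
  "adm K k \<longleftrightarrow> continuous_on {0<..<1} k \<and> (\<forall>s\<in>{0<..<1}. 0 \<le> k s \<and> k s \<le> K * h s)"

definition majorant :: "real \<Rightarrow> real \<Rightarrow> real \<Rightarrow> real" where
  "majorant K x s = (if 0 < s \<and> s < 1 then G (K * integral {s..x} h / d0) / c0 else 0)"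

section \<open>The integrable majorant\<close>

lemma admD:
  assumes "adm K k"
  shows "continuous_on {0<..<1} k" "\<And>s. 0 < s \<Longrightarrow> s < 1 \<Longrightarrow> 0 \<le> k s" "\<And>s. 0 < s \<Longrightarrow> s < 1 \<Longrightarrow> k s \<le> K * h s"
  using assms by (auto simp: adm_def)

lemma integral_weight_nonneg:
  fixes k :: "real \<Rightarrow> real"
  assumes k: "continuous_on {0<..<1} k" "\<And>s. 0 < s \<Longrightarrow> s < 1 \<Longrightarrow> 0 \<le> k s" and "0 < s" "x < 1"
  shows "0 \<le> integral {s..x} k"
  by (rule integral_nonneg) (use integrable_on_compact_part[of k] assms in auto)

lemma integral_weight_mono:
  fixes k :: "real \<Rightarrow> real"
  assumes k: "continuous_on {0<..<1} k" "\<And>s. 0 < s \<Longrightarrow> s < 1 \<Longrightarrow> 0 \<le> k s"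
    and "0 < s" "s \<le> s'" "x' \<le> x" "x < 1"
  shows "integral {s'..x'} k \<le> integral {s..x} k"
  by (rule integral_subset_le) (use integrable_on_compact_part[of k] assms in auto)

lemma h_integral_nonneg: "0 < s \<Longrightarrow> x < 1 \<Longrightarrow> 0 \<le> integral {s..x} h"
  by (rule integral_weight_nonneg[OF h_cont]) (use h_nonneg in auto)

lemma continuous_on_g:
  assumes k: "continuous_on {0<..<1} k" and x: "0 < x" "x < 1"
  shows "continuous_on {0<..<1} (g k x)"
proof -
  have ne: "\<forall>s\<in>{0<..<1}. d s \<noteq> 0" "\<forall>s\<in>{0<..<1}. c s \<noteq> 0"
    using c_bds d_bds c0 d0 by (metis atLeastAtMost_iff greaterThanLessThan_iff less_imp_le not_le)+
  have "continuous_on {0<..<1} c" "continuous_on {0<..<1} d"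
    by (auto intro: continuous_on_subset[OF c_cont] continuous_on_subset[OF d_cont])
  with ne have "continuous_on {0<..<1} (\<lambda>s. G (integral {s..x} k / d s) / c s)"
    using continuous_on_integral_lower[OF k x]
    by (intro continuous_on_divide continuous_on_compose2[OF G_cont]) auto
  then show ?thesis by (rule continuous_on_eq) (auto simp: g_def)
qed

lemma majorant_mono:
  assumes "0 \<le> K" "0 < x" "x \<le> y" "y < 1"
  shows "majorant K x s \<le> majorant K y s"
  unfolding majorant_def
  by (auto intro!: divide_right_mono G_le mult_left_mono integral_weight_mono[OF h_cont])
    (use assms h_nonneg c0 d0 in auto)

lemma majorant_nonneg:
  assumes "0 \<le> K" "x < 1"
  shows "0 \<le> majorant K x s"
  unfolding majorant_def using assms h_integral_nonneg[of s x] c0 d0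
  by (auto intro!: divide_nonneg_nonneg G_nonneg mult_nonneg_nonneg)

text \<open>\<open>G_int\<close> speaks of the position 1/2 only. For other \<open>x\<close> the
  integral is at most a part \<open>I\<close> up to 1/2 plus a constant \<open>B\<close>. As
  \<open>G\<close> need not be subadditive, \<open>I + B\<close> is replaced by
  \<open>2 * max I B\<close>, and the factor 2 is harmless because \<open>G_int\<close> holds for
  every \<open>K\<close>.\<close>

lemma majorant_integrable:
  assumes K: "0 \<le> K" and x: "0 < x" "x < 1"
  shows "majorant K x integrable_on {0..1}"
proof -
  define B where "B = integral {1/2..x} h"
  have B: "0 \<le> B" unfolding B_def by (rule h_integral_nonneg) (use x in auto)
  define b where "b = (\<lambda>s. (if s \<in> {0<..1/2} then G (2 * K / d0 * integral {s..1/2} h) else 0) / c0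
    + G (2 * K * B / d0) / c0)"
  have b_int: "b integrable_on {0<..<1}"
  proof -
    have "(\<lambda>s. if s \<in> {0<..1/2} then G (2 * K / d0 * integral {s..1/2} h) else 0) integrable_on {0<..<1}"
      unfolding integrable_restrict_Int using G_int[of "2 * K / d0"] K d0
      by (subst Int_absorb2) auto
    then have "(\<lambda>s. if s \<in> {0<..1/2} then G (2 * K / d0 * integral {s..1/2} h) else 0) integrable_on {0..1}"
      by (simp add: integrable_on_open_interval_real)
    then have "b integrable_on {0..1}"
      unfolding b_def by (intro integrable_add integrable_on_divide integrable_const_ivl)
    then show ?thesis by (simp add: integrable_on_open_interval_real)
  qed
  have majorant_meas: "majorant K x \<in> borel_measurable (lebesgue_on {0<..<1})"
  proof (rule continuous_imp_measurable_on_sets_lebesgue)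
    have "continuous_on {0<..<1} (\<lambda>s. G (K * integral {s..x} h / d0) / c0)"
      using continuous_on_integral_lower[OF h_cont x]
      by (intro continuous_intros continuous_on_compose2[OF G_cont]) (use c0 d0 in auto)
    then show "continuous_on {0<..<1} (majorant K x)"
      by (rule continuous_on_eq) (auto simp: majorant_def)
  qed simp
  have majorant_le: "norm (majorant K x s) \<le> b s" if s: "s \<in> {0<..<1}" for s
  proof -
    define I where "I = (if s \<le> 1/2 then integral {s..1/2} h else 0)"
    have I: "0 \<le> I" unfolding I_def using h_integral_nonneg[of s "1/2"] s by auto
    have "integral {s..x} h \<le> I + B"
    proof (cases "s \<le> 1/2")
      case True
      \<comment> \<open>\<open>max x (1/2)\<close> includes positions below 1/2, for which
        \<open>B\<close> is 0.\<close>
      have i2: "integral {s..1/2} h + integral {1/2..max x (1/2)} h = integral {s..max x (1/2)} h"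
        by (rule Henstock_Kurzweil_Integration.integral_combine) (use integrable_on_compact_part[OF h_cont] s x True in auto)
      have "integral {s..x} h \<le> integral {s..max x (1/2)} h"
        by (rule integral_weight_mono[OF h_cont]) (use s x h_nonneg in auto)
      also have "\<dots> = I + integral {1/2..max x (1/2)} h" using True i2 by (simp add: I_def)
      also have "integral {1/2..max x (1/2)} h = B" unfolding B_def by (cases "x < 1/2"; cases "x = 1/2") auto
      finally show ?thesis .
    next
      case False
      then show ?thesis unfolding B_def I_def using x h_nonneg
        by (auto intro!: integral_weight_mono[OF h_cont])
    qed
    also have "\<dots> \<le> 2 * max I B" by simp
    finally have "K * integral {s..x} h / d0 \<le> K * (2 * max I B) / d0"
      using K d0 by (intro divide_right_mono mult_left_mono) auto
    then have "K * integral {s..x} h / d0 \<le> 2 * K / d0 * max I B"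
      by (simp add: mult_ac)
    then have "G (K * integral {s..x} h / d0) \<le> G (2 * K / d0 * max I B)" by (rule G_le)
    also have "\<dots> \<le> G (2 * K / d0 * I) + G (2 * K / d0 * B)"
      using G_nonneg[of "2 * K / d0 * I"] G_nonneg[of "2 * K / d0 * B"] K d0 I B
      by (auto simp: max_def)
    finally have "majorant K x s \<le> (G (2 * K / d0 * I) + G (2 * K / d0 * B)) / c0"
      using c0 s by (simp add: majorant_def divide_right_mono)
    also have "\<dots> = b s" using s by (auto simp: b_def I_def add_divide_distrib)
    finally show ?thesis using majorant_nonneg[of K x s] K x by simp
  qed
  have "majorant K x integrable_on {0<..<1}"
    by (rule measurable_bounded_by_integrable_imp_integrable[OF majorant_meas b_int majorant_le]) auto
  then show ?thesis by (simp add: integrable_on_open_interval_real)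
qed


lemma g_bounds:
  assumes k: "adm K k" and K: "0 \<le> K" and x: "0 < x" "x < 1"
  shows "0 \<le> g k x s" "g k x s \<le> majorant K x s"
proof -
  have "0 \<le> g k x s \<and> g k x s \<le> majorant K x s"
  proof (cases "0 < s \<and> s < 1")
    case True
    then have cd: "0 < c s" "c0 \<le> c s" "0 < d s" "d0 \<le> d s"
      using c_bds[of s] d_bds[of s] c0 d0 by auto
    have k0: "0 \<le> integral {s..x} k"
      by (rule integral_weight_nonneg) (use admD[OF k] True x in auto)
    have "integral {s..x} k \<le> integral {s..x} (\<lambda>t. K * h t)"
      by (rule integral_le)
        (use integrable_on_compact_part[OF admD(1)[OF k]] integrable_on_compact_part[OF h_cont] admD(3)[OF k] True x
          in \<open>auto intro!: integrable_on_mult_right\<close>)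
    then have le: "integral {s..x} k \<le> K * integral {s..x} h" by simp
    then have "integral {s..x} k / d s \<le> K * integral {s..x} h / d0"
      using k0 cd d0 by (intro frac_le) auto
    then have "G (integral {s..x} k / d s) / c s \<le> G (K * integral {s..x} h / d0) / c0"
      using k0 cd c0 d0 le by (intro frac_le G_le G_nonneg) auto
    moreover have "0 \<le> G (integral {s..x} k / d s) / c s"
      using k0 cd by (intro divide_nonneg_pos G_nonneg) auto
    ultimately show ?thesis using True by (simp add: g_def majorant_def)
  qed (auto simp: g_def majorant_def)
  then show "0 \<le> g k x s" "g k x s \<le> majorant K x s" by auto
qed

lemma g_integrable:
  assumes k: "adm K k" and K: "0 \<le> K" and x: "0 < x" "x < 1"
  shows "g k x integrable_on {0..1}"
proof -
  have "g k x integrable_on {0<..<1}"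
  proof (rule measurable_bounded_by_integrable_imp_integrable[of _ _ "majorant K x"])
    show "g k x \<in> borel_measurable (lebesgue_on {0<..<1})"
      by (rule continuous_imp_measurable_on_sets_lebesgue)
        (use continuous_on_g[OF admD(1)[OF k] x] in auto)
    show "majorant K x integrable_on {0<..<1}"
      using majorant_integrable[OF K x] by (simp add: integrable_on_open_interval_real)
  qed (use g_bounds[OF k K x] in auto)
  then show ?thesis by (simp add: integrable_on_open_interval_real)
qed

lemma g_integrable_sub:
  assumes "adm K k" "0 \<le> K" "0 < x" "x < 1" "0 \<le> a" "b \<le> 1"
  shows "g k x integrable_on {a..b}"
  by (rule integrable_on_subinterval[OF g_integrable[OF assms(1-4)]]) (use assms in auto)

lemma majorant_integrable_sub:
  assumes "0 \<le> K" "0 < x" "x < 1" "0 \<le> a" "b \<le> 1"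
  shows "majorant K x integrable_on {a..b}"
  by (rule integrable_on_subinterval[OF majorant_integrable[OF assms(1-3)]]) (use assms in auto)

lemma g_zero: "x \<le> s \<Longrightarrow> g k x s = 0"
  by (cases "x = s") (auto simp: g_def)

lemma g_mono:
  assumes k: "adm K k" and x: "0 < x" "x \<le> y" "y < 1"
  shows "g k x s \<le> g k y s"
proof (cases "0 < s \<and> s < 1")
  case True
  then have cd: "0 < c s" "0 < d s" using c_bds[of s] d_bds[of s] c0 d0 by auto
  have "integral {s..x} k \<le> integral {s..y} k"
    by (rule integral_weight_mono) (use admD[OF k] x True in auto)
  with cd True show ?thesis by (simp add: g_def G_le divide_right_mono)
qed (auto simp: g_def)

section \<open>Monotonicity, equicontinuity and continuous dependence of one half\<close>

lemma L_diff:
  assumes "adm K k" "0 \<le> K" "0 < x" "x < 1" "0 \<le> s" "s \<le> t" "t \<le> 1"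
  shows "L k x t = L k x s + integral {s..t} (g k x)"
  unfolding L_def by (rule Henstock_Kurzweil_Integration.integral_combine[symmetric])
    (use g_integrable_sub[OF assms(1-4)] assms in auto)

lemma L_mono:
  assumes "adm K k" "0 \<le> K" "0 < x" "x < 1" "0 \<le> s" "s \<le> t" "t \<le> 1"
  shows "L k x s \<le> L k x t"
proof -
  have "0 \<le> integral {s..t} (g k x)"
    by (rule integral_nonneg) (use g_integrable_sub[OF assms(1-4)] g_bounds(1)[OF assms(1-4)] assms in auto)
  then show ?thesis using L_diff[OF assms] by simp
qed

lemma L_0 [simp]: "L k x 0 = 0"
  by (simp add: L_def)

lemma L_nonneg:
  assumes "adm K k" "0 \<le> K" "0 < x" "x < 1" "0 \<le> t" "t \<le> 1"
  shows "0 \<le> L k x t"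
  using L_mono[OF assms(1-4), of 0 t] assms by simp

lemma L_const:
  assumes "adm K k" "0 \<le> K" "0 < x" "x < 1" "x \<le> t" "t \<le> 1"
  shows "L k x t = L k x 1"
proof -
  have "integral {t..1} (g k x) = integral {t..1} (\<lambda>_. 0 :: real)"
    by (rule Henstock_Kurzweil_Integration.integral_cong) (use assms g_zero in auto)
  then show ?thesis using L_diff[OF assms(1-4), of t 1] assms by simp
qed

lemma L_mono_right:
  assumes k: "adm K k" and K: "0 \<le> K" and x: "0 < x" "x \<le> y" "y < 1" and t: "0 \<le> t" "t \<le> 1"
  shows "L k x t \<le> L k y t"
  unfolding L_def
proof (rule integral_le)
  show "g k x integrable_on {0..t}" "g k y integrable_on {0..t}"
    by (rule g_integrable_sub[OF k K]; use x t in simp)+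
qed (rule g_mono[OF k x])

text \<open>Increments of \<open>L k x\<close> are at most those of the primitive \<open>D\<close>
  of one majorant, whatever \<open>k\<close> is and for all \<open>x \<le> y\<close>. The bound
  \<open>y < 1\<close> is essential, since the majorant may blow up as \<open>y\<close> approaches
  1.\<close>

lemma L_modulus:
  assumes K: "0 \<le> K" and y: "0 < y" "y < 1" and e: "0 < e"
  shows "\<exists>\<delta>>0. \<forall>k x s t. adm K k \<longrightarrow> 0 < x \<longrightarrow> x \<le> y \<longrightarrow> s \<in> {0..1} \<longrightarrow> t \<in> {0..1} \<longrightarrow> \<bar>s - t\<bar> < \<delta> \<longrightarrow>
    \<bar>L k x s - L k x t\<bar> < e"
proof -
  define D where "D t = integral {0..t} (majorant K y)" for t
  have "continuous_on {0..1} D"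
    unfolding D_def by (rule indefinite_integral_continuous_1[OF majorant_integrable[OF K y]])
  then have "uniformly_continuous_on {0..1} D"
    by (rule compact_uniformly_continuous) simp
  then obtain \<delta> where \<delta>: "\<delta> > 0"
    and D: "\<And>s t. s \<in> {0..1} \<Longrightarrow> t \<in> {0..1} \<Longrightarrow> \<bar>s - t\<bar> < \<delta> \<Longrightarrow> \<bar>D s - D t\<bar> < e"
    using e unfolding uniformly_continuous_on_def dist_real_def by metis
  have le: "\<bar>L k x s - L k x t\<bar> \<le> \<bar>D s - D t\<bar>"
    if k: "adm K k" and x: "0 < x" "x \<le> y" and st: "0 \<le> s" "s \<le> t" "t \<le> 1" for k x s t
  proof -
    have x1: "x < 1" using x y by simp
    have "D t = D s + integral {s..t} (majorant K y)"
      unfolding D_def by (rule Henstock_Kurzweil_Integration.integral_combine[symmetric])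
        (use majorant_integrable_sub[OF K y] st in auto)
    moreover have "integral {s..t} (g k x) \<le> integral {s..t} (majorant K y)"
      by (rule integral_le)
        (use g_integrable_sub[OF k K x(1) x1] majorant_integrable_sub[OF K y] st
           order_trans[OF g_bounds(2)[OF k K x(1) x1] majorant_mono[OF K x y(2)]] in auto)
    ultimately show ?thesis
      using L_diff[OF k K x(1) x1 st] L_mono[OF k K x(1) x1 st] by simp
  qed
  have "\<bar>L k x s - L k x t\<bar> < e" 
    if "adm K k" "0 < x" "x \<le> y" "s \<in> {0..1}" "t \<in> {0..1}" "\<bar>s - t\<bar> < \<delta>" for k x s t
  proof -
    have "\<bar>L k x s - L k x t\<bar> \<le> \<bar>D s - D t\<bar>"
      using le[OF that(1-3), of s t] le[OF that(1-3), of t s] that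
      by (cases "s \<le> t") (auto simp: abs_minus_commute)
    then show ?thesis using D[OF that(4-6)] by simp
  qed
  then show ?thesis using \<delta> by blast
qed

text \<open>All of the rise takes place on \<open>[0, x]\<close>, so the uniform modulus makes it
  small. This later keeps the maximum away from the end points.\<close>

lemma L_small:
  assumes K: "0 \<le> K" and e: "0 < e"
  shows "\<exists>\<delta>>0. \<forall>k x. adm K k \<longrightarrow> 0 < x \<longrightarrow> x < \<delta> \<longrightarrow> L k x 1 < e"
proof -
  obtain \<delta> where \<delta>: "\<delta> > 0" and *: "\<And>k x s t. adm K k \<Longrightarrow> 0 < x \<Longrightarrow> x \<le> 1/2 \<Longrightarrow> s \<in> {0..1} \<Longrightarrow>
      t \<in> {0..1} \<Longrightarrow> \<bar>s - t\<bar> < \<delta> \<Longrightarrow> \<bar>L k x s - L k x t\<bar> < e"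
    using L_modulus[OF K, of "1/2" e] e by auto
  have "L k x 1 < e" if "adm K k" "0 < x" "x < min \<delta> (1/2)" for k x
    using *[of k x 0 x] L_const[OF that(1) K, of x x] that by auto
  then show ?thesis using \<delta> by (intro exI[of _ "min \<delta> (1/2)"]) auto
qed

text \<open>Integrand and upper limit vary together. Replacing \<open>kn n\<close> by
  \<open>k\<close> costs at most an integral over the fixed interval \<open>[s, y]\<close>, which
  tends to 0 by dominated convergence; then only the upper limit moves.\<close>

lemma integral_weight_tendsto:
  assumes k: "\<And>n. adm K (kn n)" "adm K k" and K: "0 \<le> K"
    and lim: "\<And>s. 0 < s \<Longrightarrow> s < 1 \<Longrightarrow> (\<lambda>n. kn n s) \<longlonglongrightarrow> k s"
    and x: "xn \<longlonglongrightarrow> x" "0 < x" "x < 1" "\<And>n. xn n \<le> y" "\<And>n. 0 < xn n" "y < 1" and s: "0 < s" "s < 1"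
  shows "(\<lambda>n. integral {s..xn n} (kn n)) \<longlonglongrightarrow> integral {s..x} k"
proof -
  note int = integrable_on_compact_part[OF admD(1)[OF k(1)]] integrable_on_compact_part[OF admD(1)[OF k(2)]]
  have "(\<lambda>n. integral {s..y} (\<lambda>t. \<bar>kn n t - k t\<bar>)) \<longlonglongrightarrow> integral {s..y} (\<lambda>t. 0)"
  proof (rule dominated_convergence)
    show "(\<lambda>t. \<bar>kn n t - k t\<bar>) integrable_on {s..y}" for n
      by (rule integrable_continuous_real)
        (use s x(6) in \<open>auto intro!: continuous_intros continuous_on_subset[OF admD(1)[OF k(1)]] continuous_on_subset[OF admD(1)[OF k(2)]]\<close>)
    show "(\<lambda>t. K * h t) integrable_on {s..y}"
      by (rule integrable_on_mult_right) (use integrable_on_compact_part[OF h_cont] s x in auto)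
    show "norm \<bar>kn n t - k t\<bar> \<le> K * h t" if "t \<in> {s..y}" for n t
      using admD(2,3)[OF k(1), of t n] admD(2,3)[OF k(2), of t] that s x by force
    show "(\<lambda>n. \<bar>kn n t - k t\<bar>) \<longlonglongrightarrow> 0" if "t \<in> {s..y}" for t
      using lim[of t] that s x by (auto intro: tendsto_rabs_zero simp: LIM_zero)
  qed
  then have "(\<lambda>n. integral {s..y} (\<lambda>t. \<bar>kn n t - k t\<bar>)) \<longlonglongrightarrow> 0" by simp
  then have "(\<lambda>n. integral {s..xn n} (kn n) - integral {s..xn n} k) \<longlonglongrightarrow> 0"
  proof (rule Lim_null_comparison[rotated], intro always_eventually allI)
    fix n
    have ints: "(\<lambda>t. \<bar>kn n t - k t\<bar>) integrable_on {s..b}" if "b < 1" for b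
      by (rule integrable_continuous_real)
        (use s that in \<open>auto intro!: continuous_intros continuous_on_subset[OF admD(1)[OF k(1)]] continuous_on_subset[OF admD(1)[OF k(2)]]\<close>)
    have xn: "xn n < 1" using x(4)[of n] x(6) by simp
    have "integral {s..xn n} (kn n) - integral {s..xn n} k = integral {s..xn n} (\<lambda>t. kn n t - k t)"
      by (rule Henstock_Kurzweil_Integration.integral_diff[symmetric]) (use int s xn in auto)
    also have "norm \<dots> \<le> integral {s..xn n} (\<lambda>t. \<bar>kn n t - k t\<bar>)"
      by (rule integral_norm_bound_integral) (use int s xn ints in \<open>auto intro!: integrable_diff\<close>)
    also have "\<dots> \<le> integral {s..y} (\<lambda>t. \<bar>kn n t - k t\<bar>)"
      by (rule integral_subset_le) (use ints xn x in auto)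
    finally show "norm (integral {s..xn n} (kn n) - integral {s..xn n} k) \<le> integral {s..y} (\<lambda>t. \<bar>kn n t - k t\<bar>)" .
  qed
  moreover have "(\<lambda>n. integral {s..xn n} k) \<longlonglongrightarrow> integral {s..x} k"
    by (rule continuous_on_tendsto_compose[OF continuous_on_integral_upper[OF admD(1)[OF k(2)] s] x(1)])
     (use x le_less_trans[OF x(4,6)] in auto)
  ultimately show ?thesis using tendsto_add by fastforce
qed

lemma L_tendsto:
  assumes k: "\<And>n. adm K (kn n)" "adm K k" and K: "0 \<le> K"
    and lim: "\<And>s. 0 < s \<Longrightarrow> s < 1 \<Longrightarrow> (\<lambda>n. kn n s) \<longlonglongrightarrow> k s"
    and x: "xn \<longlonglongrightarrow> x" "0 < x" "x < 1" "\<And>n. xn n \<le> y" "\<And>n. 0 < xn n" "y < 1" and t: "0 \<le> t" "t \<le> 1"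
  shows "(\<lambda>n. L (kn n) (xn n) t) \<longlonglongrightarrow> L k x t"
  unfolding L_def
proof (rule dominated_convergence)
  have xn: "xn n < 1" for n using x(4)[of n] x(6) by simp
  have y: "0 < y" using x(4,5)[of 0] by simp
  show "g (kn n) (xn n) integrable_on {0..t}" for n
    by (rule g_integrable_sub[OF k(1) K]) (use x xn t in auto)
  show "majorant K y integrable_on {0..t}"
    by (rule majorant_integrable_sub[OF K]) (use x y t in auto)
  show "norm (g (kn n) (xn n) s) \<le> majorant K y s" if "s \<in> {0..t}" for n s
    using order_trans[OF g_bounds(2)[OF k(1) K x(5) xn] majorant_mono[OF K x(5) x(4) x(6)]]
      g_bounds(1)[OF k(1) K x(5) xn] by simp
  show "(\<lambda>n. g (kn n) (xn n) s) \<longlonglongrightarrow> g k x s" if "s \<in> {0..t}" for s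
  proof (cases "0 < s \<and> s < 1")
    case True
    have "(\<lambda>n. integral {s..xn n} (kn n) / d s) \<longlonglongrightarrow> integral {s..x} k / d s"
      by (intro tendsto_intros integral_weight_tendsto[OF k K lim x]) (use True d_bds[of s] d0 in auto)
    then have "(\<lambda>n. G (integral {s..xn n} (kn n) / d s)) \<longlonglongrightarrow> G (integral {s..x} k / d s)"
      by (rule continuous_on_tendsto_compose[OF G_cont]) auto
    then show ?thesis using True c_bds[of s] c0 by (auto simp: g_def intro!: tendsto_intros)
  qed (auto simp: g_def)
qed

text \<open>For constant \<open>c\<close> and \<open>d\<close> the half would be concave, its flux
  being decreasing. In general the slope is at most \<open>W\<close> after \<open>t\<close> and at
  least \<open>k' * W\<close> before it, where \<open>k'\<close> pays for the oscillation of
  \<open>c\<close> and, through \<kappa>, of \<open>d\<close>. So the rise after \<open>t\<close> is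
  at most \<open>W\<close> and the value at \<open>t\<close> at least \<open>t * k' * W\<close>;
  comparing them gives the factor \<open>k' / (1 + k')\<close>.\<close>

lemma L_quasi_concave:
  assumes k: "adm K k" and K: "0 \<le> K" and x: "0 < x" "x < 1" and t: "0 \<le> t" "t \<le> 1"
  shows "\<kappa> * c0 / (c1 + \<kappa> * c0) * t * L k x 1 \<le> L k x t"
proof (cases "0 < t \<and> t < 1")
  case True
  define W where "W = G (integral {t..x} k / d0) / c0"
  define k' where "k' = \<kappa> * c0 / c1"
  have k': "0 < k'" unfolding k'_def using \<kappa> c0 c1 by simp
  have I0: "0 \<le> integral {t..x} k"
    by (rule integral_weight_nonneg) (use admD[OF k] True x in auto)
  have W0: "0 \<le> W" unfolding W_def using I0 c0 d0 by (intro divide_nonneg_pos G_nonneg) auto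
  have up: "g k x s \<le> W" if "s \<in> {t..1}" for s
  proof (cases "s < 1")
    case s1: True
    then have s: "0 < s" "s < 1" using that True by auto
    have cd: "c0 \<le> c s" "d0 \<le> d s" using c_bds[of s] d_bds[of s] s by auto
    have Is: "0 \<le> integral {s..x} k" "integral {s..x} k \<le> integral {t..x} k"
      by (rule integral_weight_nonneg integral_weight_mono; use admD[OF k] True x s that in auto)+
    have "g k x s = G (integral {s..x} k / d s) / c s" using s by (simp add: g_def)
    also have "\<dots> \<le> W" unfolding W_def
      using Is cd c0 d0 by (intro frac_le G_le G_nonneg) auto
    finally show ?thesis .
  qed (use W0 in \<open>auto simp: g_def\<close>)
  have low: "k' * W \<le> g k x s" if "0 < s" "s \<le> t" for s
  proof -
    have s: "0 < s" "s < 1" using that True by auto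
    have cd: "c0 \<le> c s" "c s \<le> c1" "d0 \<le> d s" "d s \<le> d1" using c_bds[of s] d_bds[of s] s by auto
    have Is: "0 \<le> integral {s..x} k" "integral {t..x} k \<le> integral {s..x} k"
      by (rule integral_weight_nonneg integral_weight_mono; use admD[OF k] True x s that in auto)+
    have "k' * W = \<kappa> * G (integral {t..x} k / d0) / c1" using c0 by (simp add: k'_def W_def)
    also have "\<dots> \<le> G (integral {t..x} k / d1) / c1"
      using \<kappa>(2)[OF I0] c1 by (simp add: divide_right_mono)
    also have "\<dots> \<le> G (integral {s..x} k / d s) / c s"
      using Is I0 cd c0 d0 d1 by (intro frac_le G_le G_nonneg) auto
    also have "\<dots> = g k x s" using s by (simp add: g_def)
    finally show ?thesis .
  qed
  have "integral {t..1} (g k x) \<le> integral {t..1} (\<lambda>_. W)"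
    by (rule integral_le) (use g_integrable_sub[OF k K x] True up in auto)
  also have "\<dots> = (1 - t) * W" using t by simp
  also have "\<dots> \<le> W" using W0 t by (simp add: mult_left_le_one_le)
  finally have 1: "integral {t..1} (g k x) \<le> W" .
  \<comment> \<open>The open interval leaves out 0, where \<open>g\<close> has its default value and
    the lower bound may fail.\<close>
  have "t * (k' * W) = integral {0<..<t} (\<lambda>_. k' * W)"
    using t by (simp add: integral_open_interval_real[symmetric])
  also have "\<dots> \<le> integral {0<..<t} (g k x)"
    by (rule integral_le) (use g_integrable_sub[OF k K x, of 0 t] True low in \<open>auto simp: integrable_on_open_interval_real\<close>)
  also have "\<dots> = L k x t" by (simp add: L_def integral_open_interval_real)
  finally have 2: "t * (k' * W) \<le> L k x t" .
  have "k' * t * L k x 1 = k' * t * L k x t + k' * t * integral {t..1} (g k x)"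
    using L_diff[OF k K x, of t 1] t by (simp add: distrib_left)
  also have "\<dots> \<le> k' * L k x t + k' * t * W"
    using 1 k' t L_nonneg[OF k K x t]
    by (intro add_mono mult_left_mono) (auto intro: mult_right_mono[of t 1, THEN order_trans] simp: mult_left_le)
  also have "\<dots> \<le> k' * L k x t + L k x t" using 2 by (simp add: mult_ac)
  finally have "k' * t * L k x 1 \<le> (1 + k') * L k x t" by (simp add: algebra_simps)
  then have "k' / (1 + k') * t * L k x 1 \<le> L k x t" using k' by (simp add: divide_simps mult_ac)
  moreover have "k' / (1 + k') = \<kappa> * c0 / (c1 + \<kappa> * c0)"
    unfolding k'_def using c1 mult_pos_pos[OF \<kappa>(1) c0] by (simp add: field_simps)
  ultimately show ?thesis by simp
next
  case False
  have "\<kappa> * c0 / (c1 + \<kappa> * c0) \<le> 1"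
    using c1 mult_pos_pos[OF \<kappa>(1) c0] by (simp add: divide_le_eq)
  then have "\<kappa> * c0 / (c1 + \<kappa> * c0) * L k x 1 \<le> 1 * L k x 1"
    using L_nonneg[OF k K x, of 1] by (intro mult_right_mono) auto
  then show ?thesis using False t by (cases "t = 0") auto
qed

text \<open>The height grows with \<open>x\<close>, and at \<open>x = 1/2\<close> it is controlled
  by \<open>G_bd\<close>. Positions up to 1/2 are enough: matching halves have equal heights, so the
  shorter half can be estimated.\<close>

lemma L_upper:
  assumes k: "adm K k" and K: "0 \<le> K" and x: "0 < x" "x \<le> 1/2"
  shows "L k x 1 \<le> Q / c0 * G (K / d0)"
proof -
  have x1: "x < 1" using x by simp
  have "L k x 1 \<le> L k (1/2) 1" by (rule L_mono_right[OF k K]) (use x in auto)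
  also have "\<dots> = L k (1/2) (1/2)" using L_const[OF k K, of "1/2" "1/2"] by simp
  also have "\<dots> \<le> integral {0..1/2} (majorant K (1/2))"
    unfolding L_def by (rule integral_le)
      (use g_integrable_sub[OF k K, of "1/2" 0 "1/2"] majorant_integrable_sub[OF K, of "1/2" 0 "1/2"] g_bounds(2)[OF k K, of "1/2"] in auto)
  also have "\<dots> = integral {0<..1/2} (majorant K (1/2))"
    by (rule integral_subset_negligible[symmetric])
     (auto intro: negligible_subset[of "{0}"])
  also have "\<dots> = integral {0<..1/2} (\<lambda>s. G (K / d0 * integral {s..1/2} h) / c0)"
    by (rule Henstock_Kurzweil_Integration.integral_cong) (auto simp: majorant_def)
  also have "\<dots> = integral {0<..1/2} (\<lambda>s. G (K / d0 * integral {s..1/2} h)) / c0" by simp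
  also have "\<dots> \<le> Q * G (K / d0) / c0"
    using G_bd[of "K / d0"] K c0 d0 by (intro divide_right_mono) auto
  finally show ?thesis by simp
qed

text \<open>Only the rise on \<open>(0, t1]\<close> is counted; there the flux is at least the mass
  of \<open>k\<close> on \<open>[t1, t0]\<close>.\<close>

lemma L_lower:
  assumes k: "adm K k" and K: "0 \<le> K" and x: "0 < t1" "t1 \<le> t0" "t0 \<le> x" "x < 1"
  shows "t1 / c1 * G (integral {t1..t0} k / d1) \<le> L k x 1"
proof -
  define W where "W = G (integral {t1..t0} k / d1) / c1"
  have I0: "0 \<le> integral {t1..t0} k"
    by (rule integral_weight_nonneg) (use admD[OF k] x in auto)
  have low: "W \<le> g k x s" if "0 < s" "s \<le> t1" for s
  proof -
    have s: "0 < s" "s < 1" using that x by auto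
    have cd: "c0 \<le> c s" "c s \<le> c1" "d0 \<le> d s" "d s \<le> d1" using c_bds[of s] d_bds[of s] s by auto
    have "integral {t1..t0} k \<le> integral {s..x} k"
      by (rule integral_weight_mono) (use admD[OF k] x that in auto)
    then have "W \<le> G (integral {s..x} k / d s) / c s"
      unfolding W_def using I0 cd c0 d0 d1 by (intro frac_le G_le G_nonneg) auto
    then show ?thesis using s by (simp add: g_def)
  qed
  have x': "0 < x" "x < 1" using x by auto
  have "t1 * W = integral {0<..<t1} (\<lambda>_. W)"
    using x by (simp add: integral_open_interval_real[symmetric])
  also have "\<dots> \<le> integral {0<..<t1} (g k x)"
    by (rule integral_le) (use g_integrable_sub[OF k K x', of 0 t1] x low in \<open>auto simp: integrable_on_open_interval_real\<close>)
  also have "\<dots> = L k x t1" by (simp add: L_def integral_open_interval_real)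
  also have "\<dots> \<le> L k x 1" by (rule L_mono[OF k K x']) (use x in auto)
  finally show ?thesis by (simp add: W_def)
qed

lemma L_continuous:
  assumes k: "adm K k" and K: "0 \<le> K" and x: "0 < x" "x < 1"
  shows "continuous_on {0..1} (L k x)"
  unfolding L_def[abs_def] by (rule indefinite_integral_continuous_1[OF g_integrable[OF k K x]])

lemma L_deriv:
  assumes k: "adm K k" and K: "0 \<le> K" and x: "0 < x" "x < 1" and t: "0 < t" "t < 1"
  shows "(L k x has_real_derivative g k x t) (at t)"
proof -
  have "continuous (at t) (g k x)"
    using continuous_on_g[OF admD(1)[OF k] x] t by (simp add: continuous_on_eq_continuous_at)
  then have "continuous (at t within ({0..1} - {})) (g k x)"
    by (rule continuous_at_imp_continuous_at_within)
  then have "((\<lambda>u. integral {0..u} (g k x)) has_vector_derivative g k x t) (at t within ({0..1} - {}))"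
    using integral_has_vector_derivative_continuous_at[OF g_integrable[OF k K x], of t "{}"] t by simp
  then have "((\<lambda>u. integral {0..u} (g k x)) has_vector_derivative g k x t) (at t within {0..1})"
    by simp
  moreover have "at t within {0..1} = at t" by (rule at_within_interior) (use t in auto)
  ultimately show ?thesis
    unfolding L_def[abs_def] has_real_derivative_iff_has_vector_derivative by simp
qed

end

section \<open>Matching the two halves\<close>

lemma has_integral_reflect_unit:
  fixes k :: "real \<Rightarrow> real"
  assumes "(k has_integral I) {a..b}"
  shows "((\<lambda>s. k (1 - s)) has_integral I) {1 - b..1 - a}"
proof (cases "a \<le> b")
  case True
  have "((\<lambda>x. k (- 1 *\<^sub>R x + 1)) has_integral (1 / \<bar>- 1\<bar> ^ DIM(real)) *\<^sub>R I) ((\<lambda>x. (1 / - 1) *\<^sub>R x + - ((1 / - 1) *\<^sub>R 1)) ` cbox a b)"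
    by (rule has_integral_affinity) (use assms in auto)
  moreover have "(\<lambda>x. (1 / - 1) *\<^sub>R x + - ((1 / - 1) *\<^sub>R 1)) ` cbox a b = {1 - b..1 - a}"
  proof -
    have "(\<lambda>x. (1 / - 1) *\<^sub>R x + - ((1 / - 1) *\<^sub>R 1)) = (\<lambda>x. 1 - x :: real)" by auto
    then show ?thesis by simp
  qed
  ultimately show ?thesis by (simp add: algebra_simps)
qed (use assms in auto)

lemma integrable_reflect_unit:
  fixes k :: "real \<Rightarrow> real"
  assumes "k integrable_on {a..b}"
  shows "(\<lambda>s. k (1 - s)) integrable_on {1 - b..1 - a}"
  using has_integral_reflect_unit assms unfolding integrable_on_def by blast

lemma integral_reflect_unit:
  fixes k :: "real \<Rightarrow> real"
  assumes "k integrable_on {a..b}"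
  shows "integral {1 - b..1 - a} (\<lambda>s. k (1 - s)) = integral {a..b} k"
  by (rule integral_unique[OF has_integral_reflect_unit]) (use assms in auto)

definition clip01 :: "real \<Rightarrow> real" where
  "clip01 y = max 0 (min 1 y)"

lemma clip01_range: "clip01 y \<in> {0..1}"
  by (simp add: clip01_def)

text \<open>A one-dimensional Poincare-Miranda principle: once the update \<open>y\<close> is known
  not to point outwards at the two ends, a fixed point of the truncated update is a zero of
  \<open>y\<close>.\<close>

lemma clip01_fixed:
  assumes "clip01 (a + y) = a"
  shows "a = 0 \<and> y \<le> 0 \<or> a = 1 \<and> y \<ge> 0 \<or> y = 0"
  using assms by (auto simp: clip01_def max_def min_def split: if_splits)

lemma tendsto_clip01: "(X \<longlongrightarrow> y) F \<Longrightarrow> ((\<lambda>n. clip01 (X n)) \<longlongrightarrow> clip01 y) F"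
  unfolding clip01_def by (intro tendsto_intros)

text \<open>The right half is the left half for the reflected data. On \<open>[t1, t2]\<close> the
  coefficient \<open>h\<close> is positive, and \<open>t0\<close> cuts this interval so that,
  wherever the maximum lies, one of the halves sees a full piece of it.\<close>

locale two_sided =
  left: half_operator G c d h c0 c1 d0 d1 \<kappa> Q +
  right: half_operator G "\<lambda>t. c (1 - t)" "\<lambda>t. d (1 - t)" "\<lambda>t. h (1 - t)" c0 c1 d0 d1 \<kappa> Q
  for G c d h :: "real \<Rightarrow> real" and c0 c1 d0 d1 \<kappa> Q :: real +
  fixes \<phi> f :: "real \<Rightarrow> real" and t0 t1 t2 :: real
  assumes \<phi>_G: "\<And>y. \<phi> (G y) = y" and \<phi>_odd: "\<And>x. \<phi> (- x) = - \<phi> x"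
    and f_cont: "continuous_on {0..} f" and f_nonneg: "\<And>s. 0 \<le> s \<Longrightarrow> 0 \<le> f s" and f_pos: "\<And>s. 0 < s \<Longrightarrow> 0 < f s"
    and ts: "0 < t1" "t1 < t0" "t0 < t2" "t2 < 1"
    and h_pos: "\<And>t. t1 \<le> t \<Longrightarrow> t \<le> t2 \<Longrightarrow> 0 < h t"
begin

definition R :: "(real \<Rightarrow> real) \<Rightarrow> real \<Rightarrow> real \<Rightarrow> real" where
  "R k x t = right.L (\<lambda>s. k (1 - s)) (1 - x) (1 - t)"

text \<open>For an arbitrary \<open>x\<close> the two halves need not meet at \<open>x\<close>; the minimum cuts the higher one
  down, so that \<open>Z k x\<close> is always continuous and attains its maximum at \<open>x\<close>.\<close>
definition Z :: "(real \<Rightarrow> real) \<Rightarrow> real \<Rightarrow> real \<Rightarrow> real" where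
  "Z k x t = min (left.L k x t) (R k x t)"

definition weight :: "real \<Rightarrow> (real \<Rightarrow> real) \<Rightarrow> real \<Rightarrow> real" where
  "weight lam u s = lam * h s * f (u s)"

definition q :: real where "q = \<kappa> * c0 / (c1 + \<kappa> * c0)"

text \<open>The minimum combines the quasi-concavity bounds of both halves, so \<open>p\<close> lies
  below every matched profile normalised to height 1.\<close>

definition p :: "real \<Rightarrow> real" where "p t = q * min t (1 - t)"

lemma q: "0 < q" "q < 1"
proof -
  have "0 < \<kappa> * c0" using left.\<kappa>(1) left.c0 by simp
  with left.c1 show "0 < q" "q < 1" unfolding q_def by (simp_all add: divide_simps)
qed

lemma p_bounds: "t \<in> {0..1} \<Longrightarrow> 0 \<le> p t \<and> p t \<le> 1"
  using q by (auto simp: p_def intro: mult_le_one)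

lemma p_pos: "0 < t \<Longrightarrow> t < 1 \<Longrightarrow> 0 < p t"
  using q by (simp add: p_def)

lemma adm_reflect:
  assumes "left.adm K k"
  shows "right.adm K (\<lambda>s. k (1 - s))"
  unfolding right.adm_def
proof
  show "continuous_on {0<..<1} (\<lambda>s. k (1 - s))"
    by (rule continuous_on_compose2[OF left.admD(1)[OF assms]]) (auto intro!: continuous_intros)
qed (use left.admD(2,3)[OF assms] in auto)

lemma reflect_weight_integral:
  assumes "left.adm K k" "0 < a" "b < 1"
  shows "integral {1 - b..1 - a} (\<lambda>s. k (1 - s)) = integral {a..b} k"
  by (rule integral_reflect_unit) (use integrable_on_compact_part[OF left.admD(1)[OF assms(1)]] assms in auto)

lemma adm_weight:
  assumes "0 \<le> lam" "continuous_on {0..1} u" "\<And>t. t \<in> {0..1} \<Longrightarrow> 0 \<le> u t \<and> u t \<le> r"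
    "\<And>s. 0 \<le> s \<Longrightarrow> s \<le> r \<Longrightarrow> f s \<le> F"
  shows "left.adm (lam * F) (weight lam u)"
  unfolding left.adm_def
proof (intro conjI ballI)
  have "continuous_on {0<..<1} (\<lambda>s. f (u s))"
    by (rule continuous_on_compose2[OF f_cont continuous_on_subset[OF assms(2)]]) (use assms(3) in auto)
  then show "continuous_on {0<..<1} (weight lam u)"
    unfolding weight_def by (intro continuous_intros left.h_cont)
  fix s :: real assume s: "s \<in> {0<..<1}"
  then have u: "0 \<le> u s" "u s \<le> r" using assms(3)[of s] by auto
  show "0 \<le> weight lam u s"
    unfolding weight_def using assms(1) left.h_nonneg[OF s] f_nonneg u by simp
  have "lam * h s * f (u s) \<le> lam * h s * F"
    using assms(1,4) left.h_nonneg[OF s] u by (intro mult_left_mono) auto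
  then show "weight lam u s \<le> lam * F * h s" by (simp add: weight_def mult_ac)
qed

lemma R_const:
  assumes "left.adm K k" "0 \<le> K" "0 < x" "x < 1" "0 \<le> t" "t \<le> x"
  shows "R k x t = R k x 0"
  unfolding R_def using right.L_const[OF adm_reflect[OF assms(1)] assms(2), of "1 - x" "1 - t"] assms by simp

text \<open>When the heights agree, on each side of \<open>x\<close> one of the halves is constantly
  \<open>N\<close>, which is also the larger value. The sum formula, unlike the minimum, can be
  differentiated across \<open>x\<close>.\<close>

lemma Z_sum:
  assumes k: "left.adm K k" and K: "0 \<le> K" and x: "0 < x" "x < 1" and N: "left.L k x 1 = N" "R k x 0 = N"
    and t: "0 \<le> t" "t \<le> 1"
  shows "Z k x t = left.L k x t + R k x t - N"
proof -
  have l: "left.L k x t \<le> N" using left.L_mono[OF k K x t(1) t(2)] N by simp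
  have r: "R k x t \<le> N" 
    using right.L_mono[OF adm_reflect[OF k] K, of "1 - x" "1 - t" 1] N x t by (simp add: R_def)
  show ?thesis
  proof (cases "t \<le> x")
    case True
    then show ?thesis using l r R_const[OF k K x t(1) True] N by (simp add: Z_def)
  next
    case False
    then show ?thesis using l r left.L_const[OF k K x _ t(2)] N by (simp add: Z_def)
  qed
qed

lemma Z_bounds:
  assumes k: "left.adm K k" and K: "0 \<le> K" and x: "0 < x" "x < 1" and t: "0 \<le> t" "t \<le> 1"
  shows "0 \<le> Z k x t" "Z k x t \<le> min (left.L k x 1) (R k x 0)"
proof -
  have "0 \<le> left.L k x t" "0 \<le> R k x t" "left.L k x t \<le> left.L k x 1" "R k x t \<le> R k x 0"
    using left.L_nonneg[OF k K x t] left.L_mono[OF k K x t(1) t(2)] x t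
      right.L_nonneg[OF adm_reflect[OF k] K, of "1 - x" "1 - t"]
      right.L_mono[OF adm_reflect[OF k] K, of "1 - x" "1 - t" 1] by (auto simp: R_def)
  then show "0 \<le> Z k x t" "Z k x t \<le> min (left.L k x 1) (R k x 0)" by (auto simp: Z_def)
qed

lemma Z_continuous:
  assumes k: "left.adm K k" and K: "0 \<le> K" and x: "0 < x" "x < 1"
  shows "continuous_on {0..1} (Z k x)"
proof -
  have "continuous_on {0..1} (\<lambda>t. R k x t)" unfolding R_def
    by (rule continuous_on_compose2[OF right.L_continuous[OF adm_reflect[OF k] K, of "1 - x"]])
      (use x in \<open>auto intro!: continuous_intros\<close>)
  then show ?thesis unfolding Z_def[abs_def]
    by (intro continuous_on_min left.L_continuous[OF k K x])
qed

lemma Z_lower: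
  assumes k: "left.adm K k" and K: "0 \<le> K" and x: "0 < x" "x < 1" and N: "left.L k x 1 = N" "R k x 0 = N"
    and t: "0 \<le> t" "t \<le> 1"
  shows "p t * N \<le> Z k x t"
proof -
  have N0: "0 \<le> N" using left.L_nonneg[OF k K x, of 1] N by simp
  have "q * t * N \<le> left.L k x t"
    using left.L_quasi_concave[OF k K x t] N by (simp add: q_def)
  moreover have "q * (1 - t) * N \<le> R k x t"
    using right.L_quasi_concave[OF adm_reflect[OF k] K, of "1 - x" "1 - t"] N t x by (simp add: q_def R_def)
  moreover have "p t * N \<le> q * t * N" "p t * N \<le> q * (1 - t) * N"
    unfolding p_def using q N0 by (intro mult_right_mono mult_left_mono; simp)+
  ultimately show ?thesis by (simp add: Z_def)
qed

text \<open>If the maximum lies right of \<open>t0\<close>, the left half collects the mass on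
  \<open>[t1, t0]\<close>, otherwise the right half that on \<open>[t0, t2]\<close>.
  \<open>E\<close> takes the worse of both, so it does not depend on \<open>x\<close>.\<close>

lemma L_peak_lower:
  assumes k: "left.adm K k" and K: "0 \<le> K" and x: "0 < x" "x < 1"
    and mu: "0 \<le> \<mu>" "\<And>s. t1 \<le> s \<Longrightarrow> s \<le> t2 \<Longrightarrow> \<mu> * h s \<le> k s"
  defines "E \<equiv> min t1 (1 - t2) / c1 * G (\<mu> * min (integral {t1..t0} h) (integral {t0..t2} h) / d1)"
  shows "t0 \<le> x \<Longrightarrow> E \<le> left.L k x 1" "x \<le> t0 \<Longrightarrow> E \<le> R k x 0"
proof -
  define H where "H = min (integral {t1..t0} h) (integral {t0..t2} h)"
  have hI: "h integrable_on {a..b}" "k integrable_on {a..b}" if "0 < a" "b < 1" for a b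
    using integrable_on_compact_part[OF left.h_cont] integrable_on_compact_part[OF left.admD(1)[OF k]] that by auto
  have H0: "0 \<le> H" unfolding H_def
    using left.h_integral_nonneg[of t1 t0] left.h_integral_nonneg[of t0 t2] ts by simp
  have kI: "\<mu> * integral {a..b} h \<le> integral {a..b} k" if "t1 \<le> a" "b \<le> t2" for a b
  proof -
    have "integral {a..b} (\<lambda>s. \<mu> * h s) \<le> integral {a..b} k"
      by (rule integral_le) (use hI[of a b] that ts mu in \<open>auto intro: integrable_on_mult_right\<close>)
    then show ?thesis by simp
  qed
  have G1: "G (\<mu> * H / d1) \<le> G (integral {a..b} k / d1)" if "t1 \<le> a" "b \<le> t2" "H \<le> integral {a..b} h" for a b
  proof (intro left.G_le divide_right_mono)
    show "\<mu> * H \<le> integral {a..b} k"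
      using mult_left_mono[OF that(3) mu(1)] kI[OF that(1,2)] by simp
  qed (use left.d1 in simp)
  have GH: "0 \<le> G (\<mu> * H / d1)" using H0 mu left.d1 by (intro left.G_nonneg) auto
  show "E \<le> left.L k x 1" if "t0 \<le> x"
  proof -
    have "E \<le> t1 / c1 * G (integral {t1..t0} k / d1)"
      unfolding E_def H_def[symmetric]
      by (intro mult_mono divide_right_mono G1) (use GH left.c1 ts in \<open>auto simp: H_def\<close>)
    also have "\<dots> \<le> left.L k x 1" by (rule left.L_lower[OF k K]) (use ts that x in auto)
    finally show ?thesis .
  qed
  show "E \<le> R k x 0" if "x \<le> t0"
  proof -
    have "E \<le> (1 - t2) / c1 * G (integral {t0..t2} k / d1)"
      unfolding E_def H_def[symmetric]
      by (intro mult_mono divide_right_mono G1) (use GH left.c1 ts in \<open>auto simp: H_def\<close>)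
    also have "integral {t0..t2} k = integral {1 - t2..1 - t0} (\<lambda>s. k (1 - s))"
      by (rule reflect_weight_integral[OF k, symmetric]) (use ts in auto)
    also have "(1 - t2) / c1 * G (\<dots> / d1) \<le> right.L (\<lambda>s. k (1 - s)) (1 - x) 1"
      by (rule right.L_lower[OF adm_reflect[OF k] K]) (use ts that x in auto)
    finally show ?thesis by (simp add: R_def)
  qed
qed

text \<open>At least one of the two integrals is always 0, so the difference is the oriented
  integral from \<open>s\<close> to \<open>x\<close>. Rebasing it at an interior point
  \<open>e\<close> avoids the singularity at 0 and covers \<open>t = x\<close> as well.\<close>

lemma signed_integral_deriv:
  assumes k: "left.adm K k" and x: "0 < x" "x < 1" and t: "0 < t" "t < 1"
  shows "((\<lambda>s. integral {s..x} k - integral {x..s} k) has_real_derivative - k t) (at t)"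
proof -
  define e where "e = min t x / 2"
  have e: "0 < e" "e < t" "e < x" unfolding e_def using x t by (auto simp: min_def)
  define b where "b = (1 + t) / 2"
  have b: "t < b" "b < 1" unfolding b_def using t by auto
  have int: "k integrable_on {a..b}" if "0 < a" "b < 1" for a b
    using integrable_on_compact_part[OF left.admD(1)[OF k]] that by auto
  have "continuous_on {e..b} k"
    by (rule continuous_on_subset[OF left.admD(1)[OF k]]) (use e b in auto)
  then have "((\<lambda>s. integral {e..s} k) has_real_derivative k t) (at t within {e..b})"
    by (rule integral_has_real_derivative) (use e b in auto)
  moreover have "at t within {e..b} = at t" by (rule at_within_interior) (use e b in auto)
  ultimately have "((\<lambda>s. integral {e..x} k - integral {e..s} k) has_real_derivative 0 - k t) (at t)"
    by (intro DERIV_diff DERIV_const) simp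
  then have "((\<lambda>s. integral {e..x} k - integral {e..s} k) has_real_derivative - k t) (at t)" by simp
  then show ?thesis
  proof (rule has_field_derivative_transform_within_open[of _ _ _ "{e<..<1}"])
    fix s assume s: "s \<in> {e<..<1}"
    show "integral {e..x} k - integral {e..s} k = integral {s..x} k - integral {x..s} k"
    proof (cases "s \<le> x")
      case True
      have "integral {e..s} k + integral {s..x} k = integral {e..x} k"
        by (rule Henstock_Kurzweil_Integration.integral_combine) (use e s True int x in auto)
      moreover have "integral {x..s} k = 0" using True by (cases "s = x") auto
      ultimately show ?thesis by simp
    next
      case False
      have "integral {e..x} k + integral {x..s} k = integral {e..s} k"
        by (rule Henstock_Kurzweil_Integration.integral_combine) (use e s False int x in auto)
      then show ?thesis using False by simp
    qed
  qed (use e t in auto)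
qed

text \<open>The derivatives of the two halves never overlap, so inverting \<open>G\<close> and using
  that \<phi> is odd turns the flux into the oriented integral of \<open>k\<close>. Hence the
  equation holds at \<open>x\<close> too, with no separate gluing argument.\<close>

lemma fixed_point_solves:
  assumes k: "left.adm K k" and K: "0 \<le> K" and x: "0 < x" "x < 1" and N: "left.L k x 1 = N" "R k x 0 = N"
    and u: "\<And>t. t \<in> {0..1} \<Longrightarrow> u t = Z k x t" and ku: "\<And>t. t \<in> {0<..<1} \<Longrightarrow> k t = weight lam u t"
    and N0: "0 < N"
  shows "is_pos_solution \<phi> c d h f lam u" "supnorm u = N"
proof -
  note k' = adm_reflect[OF k]
  have x': "0 < 1 - x" "1 - x < 1" using x by auto
  define u' where "u' = (\<lambda>t. left.g k x t - right.g (\<lambda>s. k (1 - s)) (1 - x) (1 - t))"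
  have u_eq: "u t = left.L k x t + R k x t - N" if "t \<in> {0..1}" for t
    using u[OF that] Z_sum[OF k K x N] that by simp
  have cont: "continuous_on {0..1} u"
    using Z_continuous[OF k K x] u by (metis (no_types, lifting) continuous_on_cong)
  have der: "(u has_real_derivative u' t) (at t)" if t: "t \<in> {0<..<1}" for t
  proof -
    have "((\<lambda>t. right.L (\<lambda>s. k (1 - s)) (1 - x) (1 - t)) has_real_derivative
        right.g (\<lambda>s. k (1 - s)) (1 - x) (1 - t) * - 1) (at t)"
      by (rule DERIV_chain2[OF right.L_deriv[OF k' K x']])
        (use t in \<open>auto intro!: derivative_eq_intros\<close>)
    then have "((\<lambda>t. left.L k x t + R k x t - N) has_real_derivative u' t) (at t)"
      unfolding R_def u'_def using t
      by (auto intro!: derivative_eq_intros left.L_deriv[OF k K x])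
    then show ?thesis
      by (rule has_field_derivative_transform_within_open[of _ _ _ "{0<..<1}"]) (use t u_eq in auto)
  qed
  have u'c: "continuous_on {0<..<1} u'"
    unfolding u'_def
    by (intro continuous_intros left.continuous_on_g[OF left.admD(1)[OF k] x]
        continuous_on_compose2[OF right.continuous_on_g[OF right.admD(1)[OF k'] x']]) auto
  have flux: "d t * \<phi> (c t * u' t) = integral {t..x} k - integral {x..t} k" if t: "t \<in> {0<..<1}" for t
  proof -
    have cd: "0 < c t" "0 < d t" using left.c_bds[of t] left.d_bds[of t] left.c0 left.d0 t by auto
    have g1: "left.g k x t = G (integral {t..x} k / d t) / c t" using t by (simp add: left.g_def)
    have g2: "right.g (\<lambda>s. k (1 - s)) (1 - x) (1 - t) = G (integral {x..t} k / d t) / c t"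
      using t reflect_weight_integral[OF k x(1), of t] by (simp add: right.g_def)
    show ?thesis
    proof (cases "t \<le> x")
      case True
      then have "integral {x..t} k = 0" by (cases "t = x") auto
      then show ?thesis using cd by (simp add: u'_def g1 g2 \<phi>_G)
    next
      case False
      then have "integral {t..x} k = 0" by simp
      then show ?thesis using cd by (simp add: u'_def g1 g2 \<phi>_G \<phi>_odd)
    qed
  qed
  have wder: "((\<lambda>s. d s * \<phi> (c s * u' s)) has_real_derivative - k t) (at t)" if t: "t \<in> {0<..<1}" for t
    by (rule has_field_derivative_transform_within_open[OF signed_integral_deriv[OF k x], where S = "{0<..<1}"])
      (use t flux in auto)
  have u0: "u 0 = 0" "u 1 = 0"
    using u_eq[of 0] u_eq[of 1] N by (auto simp: R_def)
  have "\<exists>w'. (\<forall>t\<in>{0<..<1}. ((\<lambda>s. d s * \<phi> (c s * u' s)) has_real_derivative w' t) (at t)) \<and>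
      continuous_on {0<..<1} w' \<and> (\<forall>t\<in>{0<..<1}. w' t + lam * h t * f (u t) = 0)"
    by (rule exI[of _ "\<lambda>t. - k t"])
      (use wder ku left.admD(1)[OF k] in \<open>auto simp: weight_def intro: continuous_on_minus\<close>)
  then have "is_solution \<phi> c d h f lam u"
    unfolding is_solution_def using cont u0 der u'c by blast
  moreover have "0 < u t" if "t \<in> {0<..<1}" for t
  proof -
    have "0 < p t * N" using p_pos[of t] N0 that by simp
    also have "\<dots> \<le> u t" using Z_lower[OF k K x N, of t] u[of t] that by simp
    finally show ?thesis .
  qed
  ultimately show "is_pos_solution \<phi> c d h f lam u"
    unfolding is_pos_solution_def by blast
  have ux: "u x = N"
    using u_eq[of x] left.L_const[OF k K x, of x] R_const[OF k K x, of x] N x by simp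
  show "supnorm u = N"
    unfolding supnorm_def
  proof (rule cSup_eq_maximum)
    show "N \<in> (\<lambda>t. \<bar>u t\<bar>) ` {0..1}" using ux N0 x by (intro image_eqI[of _ _ x]) auto
    show "y \<le> N" if "y \<in> (\<lambda>t. \<bar>u t\<bar>) ` {0..1}" for y
      using that u Z_bounds[OF k K x] N by fastforce
  qed
qed

section \<open>Solutions of prescribed norm range\<close>

definition H :: real where "H = min (integral {t1..t0} h) (integral {t0..t2} h)"

definition \<tau> :: real where "\<tau> = min t1 (1 - t2)"

text \<open>\<open>N\<close> is the norm of \<open>T u\<close>. Instead of having norm exactly
  \<open>r\<close>, \<open>u\<close> is only required to lie between \<open>r * p\<close> and
  \<open>r\<close>, which is all that the estimates of \<open>N\<close> use.\<close>

definition matched :: "real \<Rightarrow> real \<Rightarrow> (real \<Rightarrow> real) \<Rightarrow> real \<Rightarrow> real \<Rightarrow> bool" where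
  "matched lam r u x N \<longleftrightarrow> continuous_on {0..1} u \<and> (\<forall>t\<in>{0..1}. r * p t \<le> u t \<and> u t \<le> r) \<and>
    0 < x \<and> x < 1 \<and> left.L (weight lam u) x 1 = N \<and> R (weight lam u) x 0 = N"

lemma \<tau>: "0 < \<tau>" "\<tau> < 1"
  using ts by (auto simp: \<tau>_def)

lemma H_pos: "0 < H"
proof -
  have "0 < integral {a..b} h" if "t1 \<le> a" "a < b" "b \<le> t2" for a b
  proof -
    have cont: "continuous_on {a..b} h"
      by (rule continuous_on_subset[OF left.h_cont]) (use that ts in auto)
    have "0 \<le> integral {a..b} h" by (rule left.h_integral_nonneg) (use that ts in auto)
    moreover have "integral {a..b} h \<noteq> 0"
    proof
      assume "integral {a..b} h = 0"
      moreover have hp: "0 < h s" if "s \<in> {a..b}" for s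
        using h_pos[of s] that \<open>t1 \<le> a\<close> \<open>b \<le> t2\<close> by auto
      ultimately have "\<forall>s\<in>{a..b}. h s = 0"
        using integral_eq_0_iff[OF cont \<open>a < b\<close>] by (simp add: less_imp_le)
      then show False using hp[of a] \<open>a < b\<close> by auto
    qed
    ultimately show ?thesis by simp
  qed
  from this[of t1 t0] this[of t0 t2] ts show ?thesis by (simp add: H_def)
qed

lemma f_bounded:
  obtains F where "0 \<le> F" "\<And>s. 0 \<le> s \<Longrightarrow> s \<le> r \<Longrightarrow> f s \<le> F"
proof -
  have "compact (f ` {0..r})"
    by (rule compact_continuous_image[OF continuous_on_subset[OF f_cont]]) auto
  then obtain B where "\<forall>y\<in>f ` {0..r}. norm y \<le> B"
    using bounded_iff compact_imp_bounded by blast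
  then have "0 \<le> max 0 B" "\<And>s. 0 \<le> s \<Longrightarrow> s \<le> r \<Longrightarrow> f s \<le> max 0 B" by force+
  then show thesis by (rule that)
qed

lemma f_bounded_below:
  assumes "0 < a"
  obtains \<mu> where "0 < \<mu>" "\<And>s. a \<le> s \<Longrightarrow> s \<le> b \<Longrightarrow> \<mu> \<le> f s"
proof (cases "a \<le> b")
  case True
  have "continuous_on {a..b} f"
    by (rule continuous_on_subset[OF f_cont]) (use assms in auto)
  then obtain y where "y \<in> {a..b}" "\<forall>s\<in>{a..b}. f y \<le> f s"
    using continuous_attains_inf[of "{a..b}" f] True by auto
  then show thesis using that[of "f y"] f_pos[of y] assms by auto
qed (use that[of 1] in auto)

lemma matched_upper:
  assumes m: "matched lam r u x N" and lam: "0 \<le> lam" and r: "0 \<le> r"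
    and F: "0 \<le> F" "\<And>s. 0 \<le> s \<Longrightarrow> s \<le> r \<Longrightarrow> f s \<le> F"
  shows "N \<le> Q / c0 * G (lam * F / d0)"
proof -
  have uc: "continuous_on {0..1} u" using m unfolding matched_def by blast
  have u: "0 \<le> u t \<and> u t \<le> r" if "t \<in> {0..1}" for t
    using m that p_bounds[OF that] mult_nonneg_nonneg[OF r, of "p t"] unfolding matched_def by fastforce
  have k: "left.adm (lam * F) (weight lam u)"
    by (rule adm_weight[OF lam uc u F(2)])
  have K: "0 \<le> lam * F" using lam F by simp
  show ?thesis
  proof (cases "x \<le> 1/2")
    case True
    then show ?thesis using left.L_upper[OF k K, of x] m unfolding matched_def by simp
  next
    case False
    then show ?thesis using right.L_upper[OF adm_reflect[OF k] K, of "1 - x"] m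
      unfolding matched_def R_def by simp
  qed
qed

text \<open>On \<open>[t1, t2]\<close> the barrier \<open>p\<close> is at least
  \<open>q * \<tau>\<close>, so the values of \<open>u\<close> there stay in a range where
  \<open>f\<close> is bounded below. The two radii are separate because an annulus has different
  lower and upper bounds.\<close>

lemma weight_lower:
  assumes lam: "0 \<le> lam" and r: "0 \<le> r" and u: "\<And>t. t \<in> {0..1} \<Longrightarrow> r * p t \<le> u t \<and> u t \<le> r'"
    and mu: "\<And>s. q * \<tau> * r \<le> s \<Longrightarrow> s \<le> r' \<Longrightarrow> \<mu> \<le> f s" and s: "t1 \<le> s" "s \<le> t2"
  shows "lam * \<mu> * h s \<le> weight lam u s"
proof -
  have "\<tau> \<le> min s (1 - s)" using s by (auto simp: \<tau>_def)
  then have "q * \<tau> \<le> p s" unfolding p_def using q by (intro mult_left_mono) auto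
  then have "q * \<tau> * r \<le> u s" using u[of s] s ts mult_left_mono[OF _ r, of "q * \<tau>" "p s"] by (auto simp: mult_ac)
  then have "\<mu> \<le> f (u s)" using mu[of "u s"] u[of s] s ts by auto
  then have "lam * h s * \<mu> \<le> lam * h s * f (u s)"
    using lam h_pos[OF s] by (intro mult_left_mono) auto
  then show ?thesis by (simp add: weight_def mult_ac)
qed

lemma matched_lower:
  assumes m: "matched lam r u x N" and lam: "0 \<le> lam" and r: "0 \<le> r"
    and mu: "0 \<le> \<mu>" "\<And>s. q * \<tau> * r \<le> s \<Longrightarrow> s \<le> r \<Longrightarrow> \<mu> \<le> f s"
  shows "\<tau> / c1 * G (lam * \<mu> * H / d1) \<le> N"
proof -
  obtain F where F: "0 \<le> F" "\<And>s. 0 \<le> s \<Longrightarrow> s \<le> r \<Longrightarrow> f s \<le> F" using f_bounded[of r] by blast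
  have uc: "continuous_on {0..1} u" using m unfolding matched_def by blast
  have up: "r * p t \<le> u t \<and> u t \<le> r" if "t \<in> {0..1}" for t
    using m that unfolding matched_def by blast
  have u: "0 \<le> u t \<and> u t \<le> r" if "t \<in> {0..1}" for t
    using up[OF that] p_bounds[OF that] mult_nonneg_nonneg[OF r, of "p t"] by linarith
  have k: "left.adm (lam * F) (weight lam u)"
    by (rule adm_weight[OF lam uc u F(2)])
  have K: "0 \<le> lam * F" using lam F by simp
  have x: "0 < x" "x < 1" "left.L (weight lam u) x 1 = N" "R (weight lam u) x 0 = N"
    using m unfolding matched_def by auto
  have mu': "0 \<le> lam * \<mu>" using lam mu by simp
  show ?thesis
    using L_peak_lower[OF k K x(1,2) mu' weight_lower[OF lam r up mu(2)]] x(3,4)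
    unfolding H_def \<tau>_def by (cases "x \<le> t0") auto
qed

text \<open>The radial coordinate \<open>a\<close>, the position \<open>b\<close> of the maximum and the profile \<open>v\<close> are
  iterated separately. For \<open>\<sigma> = -1\<close> this reverses the radial direction, so that the expansive
  case of Krasnoselskii's theorem becomes a self-map as well. Replacing \<open>v\<close> by \<open>max v p\<close> keeps the
  weights bounded away from zero without restricting \<open>v\<close> to a cone; at a fixed point \<open>p \<le> v\<close> holds
  anyway. Similarly \<open>\<epsilon>\<close> is a lower bound for the peak of matching halves, so dividing by
  \<open>max N \<epsilon>\<close> amounts to normalising at a fixed point.\<close>
lemma solution_in_annulus:
  assumes lam: "0 < lam" and m: "0 < m" "m < M" and \<sigma>: "\<sigma> = 1 \<or> \<sigma> = - (1 :: real)"
    and inner: "\<And>u x N. matched lam m u x N \<Longrightarrow> 0 \<le> \<sigma> * (N - m)"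
    and outer: "\<And>u x N. matched lam M u x N \<Longrightarrow> \<sigma> * (N - M) \<le> 0"
  obtains u x r where "m \<le> r" "r \<le> M" "matched lam r u x r" "is_pos_solution \<phi> c d h f lam u" "supnorm u = r"
proof -
  define rad where "rad a = m + (M - m) * a" for a :: real
  have rad: "m \<le> rad a" "rad a \<le> M" if "a \<in> {0..1}" for a
  proof -
    have "0 \<le> (M - m) * a" "(M - m) * a \<le> M - m"
      using that m by (auto intro: mult_left_le)
    then show "m \<le> rad a" "rad a \<le> M" by (auto simp: rad_def)
  qed
  define U where "U a v t = rad a * max (v t) (p t)" for a and v :: "real \<Rightarrow> real" and t
  obtain F where F: "0 \<le> F" "\<And>s. 0 \<le> s \<Longrightarrow> s \<le> M \<Longrightarrow> f s \<le> F" using f_bounded[of M] by blast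
  define K where "K = lam * F"
  have K: "0 \<le> K" using lam F by (simp add: K_def)
  have U: "continuous_on {0..1} (U a v)" "\<And>t. t \<in> {0..1} \<Longrightarrow> rad a * p t \<le> U a v t \<and> U a v t \<le> rad a"
    if "a \<in> {0..1}" "unit_fun v" for a v
  proof -
    show "continuous_on {0..1} (U a v)"
      unfolding U_def p_def using that(2) by (intro continuous_intros) (auto simp: unit_fun_def)
    show "rad a * p t \<le> U a v t \<and> U a v t \<le> rad a" if t: "t \<in> {0..1}" for t
    proof
      have r0: "0 \<le> rad a" using rad(1)[OF \<open>a \<in> {0..1}\<close>] m by simp
      then show "rad a * p t \<le> U a v t" unfolding U_def by (intro mult_left_mono) auto
      have "v t \<le> 1" using \<open>unit_fun v\<close> t unfolding unit_fun_def by auto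
      then have "max (v t) (p t) \<le> 1" using p_bounds[OF t] by simp
      then show "U a v t \<le> rad a" unfolding U_def using r0 by (simp add: mult_left_le)
    qed
  qed
  have U0: "0 \<le> U a v t \<and> U a v t \<le> M" if "a \<in> {0..1}" "unit_fun v" "t \<in> {0..1}" for a v t
    using U(2)[OF that] rad[OF that(1)] m p_bounds[OF that(3)] mult_nonneg_nonneg[of "rad a" "p t"] by linarith
  define W where "W a v = weight lam (U a v)" for a v
  have W: "left.adm K (W a v)" if "a \<in> {0..1}" "unit_fun v" for a v
    unfolding K_def W_def by (rule adm_weight[OF _ U(1)[OF that] _ F(2)]) (use lam U0[OF that] in auto)
  \<comment> \<open>A lower bound of \<open>f\<close> on all values that any \<open>U a v\<close>
    takes on \<open>[t1, t2]\<close>; it makes \<epsilon> independent of \<open>a\<close>,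
    \<open>b\<close> and \<open>v\<close>.\<close>
  obtain \<mu> where \<mu>: "0 < \<mu>" "\<And>s. q * \<tau> * m \<le> s \<Longrightarrow> s \<le> M \<Longrightarrow> \<mu> \<le> f s"
    using f_bounded_below[of "q * \<tau> * m" M] q \<tau> m by auto
  define \<epsilon> where "\<epsilon> = \<tau> / c1 * G (lam * \<mu> * H / d1)"
  have "0 < lam * \<mu> * H / d1" using lam \<mu> H_pos left.d1 by simp
  then have "0 < G (lam * \<mu> * H / d1)"
    using left.G_mono left.G0 by (metis strict_mono_less)
  then have \<epsilon>: "0 < \<epsilon>" unfolding \<epsilon>_def using \<tau> left.c1 by simp
  have peak: "t0 \<le> x \<Longrightarrow> \<epsilon> \<le> left.L (W a v) x 1" "x \<le> t0 \<Longrightarrow> \<epsilon> \<le> R (W a v) x 0"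
    if "a \<in> {0..1}" "unit_fun v" "0 < x" "x < 1" for a v x
  proof -
    have mu': "0 \<le> lam * \<mu>" using lam \<mu> by simp
    have "m * p t \<le> U a v t \<and> U a v t \<le> M" if t: "t \<in> {0..1}" for t
      using U(2)[OF \<open>a \<in> {0..1}\<close> \<open>unit_fun v\<close> t] rad[OF \<open>a \<in> {0..1}\<close>] p_bounds[OF t]
        mult_right_mono[of m "rad a" "p t"] by linarith
    then have "lam * \<mu> * h s \<le> W a v s" if "t1 \<le> s" "s \<le> t2" for s
      unfolding W_def using lam m \<mu>(2) that by (intro weight_lower[of _ m _ M]) auto
    from L_peak_lower[OF W[OF that(1,2)] K that(3,4) mu' this]
    show "t0 \<le> x \<Longrightarrow> \<epsilon> \<le> left.L (W a v) x 1" "x \<le> t0 \<Longrightarrow> \<epsilon> \<le> R (W a v) x 0"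
      unfolding \<epsilon>_def H_def \<tau>_def by auto
  qed
  obtain \<delta>l where \<delta>l: "0 < \<delta>l" "\<And>k x. left.adm K k \<Longrightarrow> 0 < x \<Longrightarrow> x < \<delta>l \<Longrightarrow> left.L k x 1 < \<epsilon>"
    using left.L_small[OF K \<epsilon>] by blast
  obtain \<delta>r where \<delta>r: "0 < \<delta>r" "\<And>k x. right.adm K k \<Longrightarrow> 0 < x \<Longrightarrow> x < \<delta>r \<Longrightarrow> right.L k x 1 < \<epsilon>"
    using right.L_small[OF K \<epsilon>] by blast
  \<comment> \<open>Below both thresholds, a maximum at distance \<eta> from an end leaves the
    adjacent half lower than \<epsilon>. The bounds by \<open>t0\<close> put \<eta> and
    \<open>1 - \<eta>\<close> on opposite sides of \<open>t0\<close>, so that \<open>peak\<close>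
    makes the other half at least \<epsilon>.\<close>
  define \<eta> where "\<eta> = min (min (\<delta>l / 2) (\<delta>r / 2)) (min (t0 / 2) ((1 - t0) / 2))"
  have \<eta>: "0 < \<eta>" "\<eta> < \<delta>l" "\<eta> < \<delta>r" "\<eta> < t0" "\<eta> < 1 - t0" "\<eta> < 1/2"
    unfolding \<eta>_def using \<delta>l \<delta>r ts by (auto simp: min_def)
  define pos where "pos b = \<eta> + (1 - 2 * \<eta>) * b" for b :: real
  have pos: "\<eta> \<le> pos b" "pos b \<le> 1 - \<eta>" if "b \<in> {0..1}" for b
  proof -
    have "0 \<le> (1 - 2 * \<eta>) * b" "(1 - 2 * \<eta>) * b \<le> 1 - 2 * \<eta>"
      using that \<eta> by (auto intro: mult_left_le)
    then show "\<eta> \<le> pos b" "pos b \<le> 1 - \<eta>" by (auto simp: pos_def)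
  qed
  have pos1: "0 < pos b" "pos b < 1" if "b \<in> {0..1}" for b
    using pos[OF that] \<eta> by auto
  define l where "l a b v = left.L (W a v) (pos b) 1" for a b v
  define r where "r a b v = R (W a v) (pos b) 0" for a b v
  define n where "n a b v = min (l a b v) (r a b v)" for a b v
  define A where "A a b v = clip01 (a + \<sigma> * (n a b v - rad a))" for a b v
  \<comment> \<open>A higher right half pushes the maximum to the right, which raises the left half
    and lowers the right one.\<close>
  define B where "B a b v = clip01 (b + (r a b v - l a b v))" for a b v
  define V where "V a b v t = Z (W a v) (pos b) t / max (n a b v) \<epsilon>" for a b v t
  have range: "A a b v \<in> {0..1} \<and> B a b v \<in> {0..1} \<and> (\<forall>t\<in>{0..1}. V a b v t \<in> {0..1})"
    if "a \<in> {0..1}" "b \<in> {0..1}" "unit_fun v" for a b v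
  proof -
    have "V a b v t \<in> {0..1}" if t: "t \<in> {0..1}" for t
      using Z_bounds[OF W[OF \<open>a \<in> {0..1}\<close> \<open>unit_fun v\<close>] K pos1[OF \<open>b \<in> {0..1}\<close>], of t] t \<epsilon>
      by (auto simp: V_def n_def l_def r_def divide_le_eq)
    then show ?thesis using clip01_range unfolding A_def B_def by blast
  qed
  have equi: "\<exists>\<delta>>0. \<forall>a\<in>{0..1}. \<forall>b\<in>{0..1}. \<forall>v. unit_fun v \<longrightarrow>
      (\<forall>s\<in>{0..1}. \<forall>t\<in>{0..1}. \<bar>s - t\<bar> < \<delta> \<longrightarrow> \<bar>V a b v s - V a b v t\<bar> < e)" if e: "0 < e" for e
  proof -
    have e': "0 < e * \<epsilon>" using e \<epsilon> by simp
    have \<eta>1: "0 < 1 - \<eta>" "1 - \<eta> < 1" using \<eta> by auto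
    obtain \<delta>1 where \<delta>1: "0 < \<delta>1" "\<And>k x s t. left.adm K k \<Longrightarrow> 0 < x \<Longrightarrow> x \<le> 1 - \<eta> \<Longrightarrow> s \<in> {0..1} \<Longrightarrow> t \<in> {0..1}
        \<Longrightarrow> \<bar>s - t\<bar> < \<delta>1 \<Longrightarrow> \<bar>left.L k x s - left.L k x t\<bar> < e * \<epsilon>"
      using left.L_modulus[OF K \<eta>1 e'] by blast
    obtain \<delta>2 where \<delta>2: "0 < \<delta>2" "\<And>k x s t. right.adm K k \<Longrightarrow> 0 < x \<Longrightarrow> x \<le> 1 - \<eta> \<Longrightarrow> s \<in> {0..1} \<Longrightarrow> t \<in> {0..1}
        \<Longrightarrow> \<bar>s - t\<bar> < \<delta>2 \<Longrightarrow> \<bar>right.L k x s - right.L k x t\<bar> < e * \<epsilon>"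
      using right.L_modulus[OF K \<eta>1 e'] by blast
    have "\<bar>V a b v s - V a b v t\<bar> < e" if a: "a \<in> {0..1}" and b: "b \<in> {0..1}" and v: "unit_fun v"
      and s: "s \<in> {0..1}" and t: "t \<in> {0..1}" and st: "\<bar>s - t\<bar> < min \<delta>1 \<delta>2" for a b v s t
    proof -
      have "\<bar>left.L (W a v) (pos b) s - left.L (W a v) (pos b) t\<bar> < e * \<epsilon>"
        using \<delta>1(2)[OF W[OF a v] pos1(1)[OF b] pos(2)[OF b] s t] st by simp
      moreover have "\<bar>R (W a v) (pos b) s - R (W a v) (pos b) t\<bar> < e * \<epsilon>"
        unfolding R_def using \<delta>2(2)[OF adm_reflect[OF W[OF a v]], of "1 - pos b" "1 - s" "1 - t"]
          pos[OF b] pos1[OF b] s t st by auto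
      ultimately have *: "\<bar>Z (W a v) (pos b) s - Z (W a v) (pos b) t\<bar> < e * \<epsilon>"
        unfolding Z_def by linarith
      have "\<bar>V a b v s - V a b v t\<bar> = \<bar>Z (W a v) (pos b) s - Z (W a v) (pos b) t\<bar> / max (n a b v) \<epsilon>"
        unfolding V_def diff_divide_distrib[symmetric] using \<epsilon> by simp
      also have "\<dots> \<le> \<bar>Z (W a v) (pos b) s - Z (W a v) (pos b) t\<bar> / \<epsilon>"
        using \<epsilon> by (intro divide_left_mono) auto
      also have "\<dots> < e" using * \<epsilon> by (simp add: divide_less_eq)
      finally show ?thesis .
    qed
    then show ?thesis using \<delta>1(1) \<delta>2(1) by (intro exI[of _ "min \<delta>1 \<delta>2"]) auto
  qed
  have cont: "(\<lambda>i. A (an i) (bn i) (vn i)) \<longlonglongrightarrow> A a b v \<and> (\<lambda>i. B (an i) (bn i) (vn i)) \<longlonglongrightarrow> B a b v \<and>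
        (\<forall>t\<in>{0..1}. (\<lambda>i. V (an i) (bn i) (vn i) t) \<longlonglongrightarrow> V a b v t)"
    if an: "\<And>i. an i \<in> {0..1}" and bn: "\<And>i. bn i \<in> {0..1}" and vn: "\<And>i. unit_fun (vn i)"
      and a: "a \<in> {0..1}" and b: "b \<in> {0..1}" and v: "unit_fun v"
      and la: "an \<longlonglongrightarrow> a" and lb: "bn \<longlonglongrightarrow> b" and lv: "uniform_limit {0..1} vn v sequentially"
    for an bn vn a b v
  proof -
    have lrad: "(\<lambda>i. rad (an i)) \<longlonglongrightarrow> rad a" unfolding rad_def by (intro tendsto_intros la)
    have lpos: "(\<lambda>i. pos (bn i)) \<longlonglongrightarrow> pos b" unfolding pos_def by (intro tendsto_intros lb)
    have lU: "(\<lambda>i. U (an i) (vn i) s) \<longlonglongrightarrow> U a v s" if "s \<in> {0..1}" for s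
      unfolding U_def by (intro tendsto_intros lrad tendsto_uniform_limitI[OF lv that])
    have lW: "(\<lambda>i. W (an i) (vn i) s) \<longlonglongrightarrow> W a v s" if "0 < s" "s < 1" for s
      unfolding W_def weight_def
    proof (intro tendsto_intros continuous_on_tendsto_compose[OF f_cont lU])
      show "s \<in> {0..1}" "U a v s \<in> {0..}" "\<forall>\<^sub>F i in sequentially. U (an i) (vn i) s \<in> {0..}"
        using that U0[OF a v, of s] U0[OF an vn, of s] by auto
    qed
    have lL: "(\<lambda>i. left.L (W (an i) (vn i)) (pos (bn i)) t) \<longlonglongrightarrow> left.L (W a v) (pos b) t" if "t \<in> {0..1}" for t
      by (rule left.L_tendsto[OF W[OF an vn] W[OF a v] K lW lpos pos1[OF b] pos(2)[OF bn] pos1(1)[OF bn]])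
        (use \<eta> that in auto)
    have lR: "(\<lambda>i. R (W (an i) (vn i)) (pos (bn i)) t) \<longlonglongrightarrow> R (W a v) (pos b) t" if "t \<in> {0..1}" for t
      unfolding R_def
    proof (rule right.L_tendsto[OF adm_reflect[OF W[OF an vn]] adm_reflect[OF W[OF a v]] K])
      show "(\<lambda>i. 1 - pos (bn i)) \<longlonglongrightarrow> 1 - pos b" by (intro tendsto_intros lpos)
      show "1 - pos (bn i) \<le> 1 - \<eta>" for i using pos(1)[OF bn] by simp
      show "0 < 1 - pos (bn i)" for i using pos1(2)[OF bn] by simp
    qed (use lW pos1[OF b] \<eta> that in auto)
    have ll: "(\<lambda>i. l (an i) (bn i) (vn i)) \<longlonglongrightarrow> l a b v" unfolding l_def by (rule lL) simp
    have lr: "(\<lambda>i. r (an i) (bn i) (vn i)) \<longlonglongrightarrow> r a b v" unfolding r_def by (rule lR) simp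
    have ln: "(\<lambda>i. n (an i) (bn i) (vn i)) \<longlonglongrightarrow> n a b v" unfolding n_def by (intro tendsto_min ll lr)
    have "(\<lambda>i. V (an i) (bn i) (vn i) t) \<longlonglongrightarrow> V a b v t" if "t \<in> {0..1}" for t
      unfolding V_def Z_def
      by (intro tendsto_divide tendsto_min tendsto_max tendsto_const lL[OF that] lR[OF that] ln) (use \<epsilon> in auto)
    then show ?thesis
      unfolding A_def B_def by (intro conjI ballI tendsto_clip01 tendsto_intros la lb ln lrad ll lr) auto
  qed
  obtain a b v where a: "a \<in> {0..1}" and b: "b \<in> {0..1}" and v: "unit_fun v"
    and fA: "A a b v = a" and fB: "B a b v = b" and fV: "\<forall>t\<in>{0..1}. V a b v t = v t"
    using schauder_unit_interval[of A B V, OF range equi cont] by blast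
  define x where "x = pos b"
  have x: "0 < x" "x < 1" unfolding x_def using pos1[OF b] .
  \<comment> \<open>At either extreme position the lower half is the adjacent one, so the update
    points inwards and truncation cannot be active there.\<close>
  have lr: "l a b v = r a b v"
  proof -
    have "\<not> (b = 0 \<and> r a b v - l a b v \<le> 0)"
    proof
      assume *: "b = 0 \<and> r a b v - l a b v \<le> 0"
      then have "x = \<eta>" by (simp add: x_def pos_def)
      then have "l a b v < \<epsilon>" "\<epsilon> \<le> r a b v"
        using \<delta>l(2)[OF W[OF a v] x(1)] peak(2)[OF a v x] \<eta> by (auto simp: l_def r_def x_def)
      with * show False by simp
    qed
    moreover have "\<not> (b = 1 \<and> 0 \<le> r a b v - l a b v)"
    proof
      assume *: "b = 1 \<and> 0 \<le> r a b v - l a b v"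
      then have "x = 1 - \<eta>" by (simp add: x_def pos_def)
      then have "r a b v < \<epsilon>" "\<epsilon> \<le> l a b v"
        using \<delta>r(2)[OF adm_reflect[OF W[OF a v]], of \<eta>] peak(1)[OF a v x] \<eta> by (auto simp: l_def r_def x_def R_def)
      with * show False by simp
    qed
    ultimately show ?thesis using clip01_fixed[OF fB[unfolded B_def]] by auto
  qed
  define N where "N = n a b v"
  have N: "left.L (W a v) x 1 = N" "R (W a v) x 0 = N"
    using lr by (auto simp: N_def n_def l_def r_def x_def)
  have N\<epsilon>: "\<epsilon> \<le> N"
    using peak[OF a v x] N by (cases "t0 \<le> x") auto
  have vZ: "v t = Z (W a v) x t / N" if "t \<in> {0..1}" for t
    using fV that N\<epsilon> by (auto simp: V_def N_def x_def max_absorb1)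
  \<comment> \<open>With equal heights, quasi-concavity applies to \<open>v\<close> itself; the
    maximum in \<open>U\<close> is then inactive and \<open>U a v\<close> coincides with its
    image.\<close>
  have vp: "p t \<le> v t" if "t \<in> {0..1}" for t
    using Z_lower[OF W[OF a v] K x N, of t] vZ[OF that] that N\<epsilon> \<epsilon> by (simp add: le_divide_eq)
  have match: "matched lam (rad a) (U a v) x N"
    unfolding matched_def using U[OF a v] x N by (auto simp: W_def)
  \<comment> \<open>Weak inequalities suffice: at an end of the annulus, \<open>inner\<close> or
    \<open>outer\<close> and the truncation bound the same quantity from opposite sides.\<close>
  have "\<sigma> * (N - rad a) = 0"
  proof -
    have "0 \<le> \<sigma> * (N - rad a)" if "a = 0" using inner[of "U a v" x N] match that by (simp add: rad_def)
    moreover have "\<sigma> * (N - rad a) \<le> 0" if "a = 1" using outer[of "U a v" x N] match that by (simp add: rad_def)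
    ultimately show ?thesis using clip01_fixed[OF fA[unfolded A_def]] by (auto simp: N_def)
  qed
  then have Nr: "N = rad a" using \<sigma> by auto
  have UZ: "U a v t = Z (W a v) x t" if "t \<in> {0..1}" for t
    using vZ[OF that] vp[OF that] Nr N\<epsilon> \<epsilon> by (simp add: U_def max_absorb1)
  have "is_pos_solution \<phi> c d h f lam (U a v)" "supnorm (U a v) = N"
    by (rule fixed_point_solves[OF W[OF a v] K x N UZ]; use N\<epsilon> \<epsilon> in \<open>simp add: W_def\<close>)+
  then show thesis
    using that[of "rad a" "U a v" x] match Nr rad[OF a] by simp
qed

end

section \<open>Existence of two solutions\<close>

lemma inc_homeo_nonneg_inv:
  assumes "inc_homeo_nonneg \<psi>" "0 \<le> y"
  shows "\<psi> (inv_into {0..} \<psi> y) = y" "0 \<le> inv_into {0..} \<psi> y" "0 < y \<Longrightarrow> 0 < inv_into {0..} \<psi> y"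
proof -
  obtain g where g: "homeomorphism {0..} {0..} \<psi> g" using assms by (auto simp: inc_homeo_nonneg_def)
  have sm: "strict_mono_on {0..} \<psi>" using assms by (simp add: inc_homeo_nonneg_def)
  have im: "\<psi> ` {0..} = {0..}" using g by (simp add: homeomorphism_def)
  then have y: "y \<in> \<psi> ` {0..}" using assms by simp
  show 1: "\<psi> (inv_into {0..} \<psi> y) = y" by (rule f_inv_into_f[OF y])
  show 2: "0 \<le> inv_into {0..} \<psi> y" using inv_into_into[OF y] by simp
  have "0 \<in> \<psi> ` {0..}" using im by simp
  then obtain z where z: "0 \<le> z" "\<psi> z = 0" by (metis atLeast_iff imageE)
  have "\<psi> 0 \<ge> 0" using im by blast
  then have "\<psi> 0 = 0" using strict_mono_onD[OF sm, of 0 z] z by (cases "z = 0") auto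
  then show "0 < inv_into {0..} \<psi> y" if "0 < y" using 1 2 that by (cases "inv_into {0..} \<psi> y = 0") auto
qed

lemma inc_homeo_nonneg_ge0:
  assumes "inc_homeo_nonneg \<psi>" "0 \<le> x"
  shows "0 \<le> \<psi> x"
proof -
  obtain g where "homeomorphism {0..} {0..} \<psi> g" using assms by (auto simp: inc_homeo_nonneg_def)
  then have "\<psi> ` {0..} = {0..}" by (simp add: homeomorphism_def)
  then show ?thesis using assms(2) by blast
qed

text \<open>Here \<psi> stands for the inverse of \<psi>1, for which condition (A) becomes
  \<open>le\<close>. It moves the factor \<open>K\<close> out of \<open>G\<close>, so integrability
  for one \<open>K\<close> gives it for all, with a bound linear in \<open>G K\<close>.\<close>

lemma half_integrability:
  fixes G \<psi> h :: "real \<Rightarrow> real"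
  assumes G: "continuous_on UNIV G" "\<And>y. 0 \<le> y \<Longrightarrow> 0 \<le> G y"
    and h: "continuous_on {0<..<1} h" "\<And>t. t \<in> {0<..<1} \<Longrightarrow> 0 \<le> h t"
    and le: "\<And>K y. 0 \<le> K \<Longrightarrow> 0 \<le> y \<Longrightarrow> G (K * y) \<le> G K * \<psi> y"
    and int: "(\<lambda>s. \<psi> (integral {s..1/2} h)) integrable_on {0<..1/2}" and K: "0 \<le> K"
    and Q: "integral {0<..1/2} (\<lambda>s. \<psi> (integral {s..1/2} h)) \<le> Q"
  shows "(\<lambda>s. G (K * integral {s..1/2} h)) integrable_on {0<..1/2}"
    "integral {0<..1/2} (\<lambda>s. G (K * integral {s..1/2} h)) \<le> Q * G K"
proof -
  have I: "0 \<le> integral {s..1/2} h" if "s \<in> {0<..1/2}" for s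
    by (rule integral_nonneg) (use integrable_on_compact_part[OF h(1)] h(2) that in auto)
  have bd: "0 \<le> G (K * integral {s..1/2} h)" "G (K * integral {s..1/2} h) \<le> G K * \<psi> (integral {s..1/2} h)"
    if "s \<in> {0<..1/2}" for s
    using G(2) le[OF K I[OF that]] I[OF that] K by auto
  have dom: "(\<lambda>s. G K * \<psi> (integral {s..1/2} h)) integrable_on {0<..1/2}"
    by (rule integrable_on_mult_right[OF int])
  show 1: "(\<lambda>s. G (K * integral {s..1/2} h)) integrable_on {0<..1/2}"
  proof (rule measurable_bounded_by_integrable_imp_integrable[OF _ dom])
    have "continuous_on {0<..1/2} (\<lambda>s. integral {s..1/2} h)"
      by (rule continuous_on_subset[OF continuous_on_integral_lower[OF h(1), of "1/2"]]) auto
    then have "continuous_on {0<..1/2} (\<lambda>s. G (K * integral {s..1/2} h))"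
      by (intro continuous_on_compose2[OF G(1)] continuous_intros) auto
    then show "(\<lambda>s. G (K * integral {s..1/2} h)) \<in> borel_measurable (lebesgue_on {0<..1/2})"
      by (rule continuous_imp_measurable_on_sets_lebesgue) simp
  qed (use bd in auto)
  have "integral {0<..1/2} (\<lambda>s. G (K * integral {s..1/2} h)) \<le> integral {0<..1/2} (\<lambda>s. G K * \<psi> (integral {s..1/2} h))"
    by (rule integral_le[OF 1 dom]) (use bd in auto)
  also have "\<dots> = G K * integral {0<..1/2} (\<lambda>s. \<psi> (integral {s..1/2} h))" by simp
  also have "\<dots> \<le> G K * Q" using Q G(2)[OF K] by (rule mult_left_mono)
  finally show "integral {0<..1/2} (\<lambda>s. G (K * integral {s..1/2} h)) \<le> Q * G K" by (simp add: mult.commute)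
qed

lemma reflected_half_integrable:
  fixes \<psi> h :: "real \<Rightarrow> real"
  assumes h: "continuous_on {0<..<1} h" and int: "(\<lambda>s. \<psi> (integral {1/2..s} h)) integrable_on {1/2..<1}"
  shows "(\<lambda>s. \<psi> (integral {s..1/2} (\<lambda>t. h (1 - t)))) integrable_on {0<..1/2}"
proof -
  have "(\<lambda>s. \<psi> (integral {1/2..s} h)) integrable_on {1/2..1}"
    using int by (rule integrable_spike_set) (auto intro: negligible_subset[of "{1}"])
  then have "(\<lambda>s. \<psi> (integral {1/2..1 - s} h)) integrable_on {1 - 1..1 - 1/2}"
    by (rule integrable_reflect_unit)
  then have "(\<lambda>s. \<psi> (integral {1/2..1 - s} h)) integrable_on {0..1/2}" by simp
  then have "(\<lambda>s. \<psi> (integral {1/2..1 - s} h)) integrable_on {0<..1/2}"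
    by (rule integrable_spike_set) (auto intro: negligible_subset[of "{0}"])
  moreover have "\<psi> (integral {1/2..1 - s} h) = \<psi> (integral {s..1/2} (\<lambda>t. h (1 - t)))" if "s \<in> {0<..1/2}" for s
  proof -
    have "integral {1 - (1 - s)..1 - 1/2} (\<lambda>t. h (1 - t)) = integral {1/2..1 - s} h"
      by (rule integral_reflect_unit) (use integrable_on_compact_part[OF h] that in auto)
    then show ?thesis by simp
  qed
  ultimately show ?thesis by (rule integrable_eq)
qed

text \<open>Existence of large values for small \<open>lam\<close> does not make an arbitrary
  selection diverge. So \<open>Y lam\<close> is chosen within a factor 2 of every other candidate,
  or at least \<open>1 / lam\<close> if the candidates are unbounded.\<close>

lemma divergent_selection:
  fixes P :: "real \<Rightarrow> real \<Rightarrow> bool"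
  assumes ex: "\<And>lam. lam \<in> {0<..<L} \<Longrightarrow> \<exists>y>1. P lam y" and L: "0 < L"
    and large: "\<And>K. 1 < K \<Longrightarrow> \<exists>l>0. \<forall>lam\<in>{0<..<l}. \<exists>y\<ge>K. P lam y"
  obtains Y where "\<And>lam. lam \<in> {0<..<L} \<Longrightarrow> 1 < Y lam \<and> P lam (Y lam)"
    "filterlim Y at_top (at_right 0)"
proof -
  have "\<exists>y. 1 < y \<and> P lam y \<and> ((\<forall>z>1. P lam z \<longrightarrow> z \<le> 2 * y) \<or> 1 / lam \<le> y)"
    if lam: "lam \<in> {0<..<L}" for lam
  proof -
    define S where "S = {y. 1 < y \<and> P lam y}"
    have S: "S \<noteq> {}" using ex[OF lam] by (auto simp: S_def)
    show ?thesis
    proof (cases "bdd_above S")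
      case True
      obtain y where "y \<in> S" using S by blast
      then have "1 < Sup S" using cSup_upper[OF _ True, of y] by (auto simp: S_def)
      then have "Sup S / 2 < Sup S" by simp
      then obtain y where y: "y \<in> S" "Sup S / 2 < y"
        using less_cSup_iff[OF S True] by blast
      have "z \<le> 2 * y" if "1 < z" "P lam z" for z
        using cSup_upper[OF _ True, of z] that y by (simp add: S_def)
      then show ?thesis using y by (auto simp: S_def)
    next
      case False
      then obtain y where "y \<in> S" "1 / lam < y" by (meson bdd_above.I not_le)
      then show ?thesis by (auto simp: S_def)
    qed
  qed
  then obtain Y where Y: "\<And>lam. lam \<in> {0<..<L} \<Longrightarrow> 1 < Y lam \<and> P lam (Y lam) \<and>
      ((\<forall>z>1. P lam z \<longrightarrow> z \<le> 2 * Y lam) \<or> 1 / lam \<le> Y lam)"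
    by metis
  have "filterlim Y at_top (at_right 0)"
  proof (subst filterlim_at_top_gt[where c = 1], intro allI impI)
    fix K :: real assume K: "1 < K"
    \<comment> \<open>Asking for \<open>2 * K\<close> pays for the factor 2; the later restriction
      \<open>lam < 1 / K\<close> serves the unbounded case.\<close>
    obtain l where l: "0 < l" "\<And>lam. lam \<in> {0<..<l} \<Longrightarrow> \<exists>y\<ge>2 * K. P lam y"
      using large[of "2 * K"] K by auto
    have "\<forall>\<^sub>F lam in at_right 0. lam \<in> {0<..<min (min l L) (1 / K)}"
      by (rule eventually_at_right_real) (use l L K in auto)
    then show "\<forall>\<^sub>F lam in at_right 0. K \<le> Y lam"
    proof eventually_elim
      case (elim lam)
      then obtain y where y: "2 * K \<le> y" "P lam y" using l(2)[of lam] by auto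
      have "K \<le> 1 / lam" using elim K by (simp add: field_simps)
      moreover have "lam \<in> {0<..<L}" using elim by auto
      moreover have "K \<le> Y lam" if "\<forall>z>1. P lam z \<longrightarrow> z \<le> 2 * Y lam"
      proof -
        have "1 < y" using y K by simp
        with that y have "y \<le> 2 * Y lam" by blast
        with y show ?thesis by simp
      qed
      ultimately show ?case using Y[of lam] by (metis order_trans)
    qed
  qed
  then show thesis using that Y by blast
qed

theorem theorem3p7:
  fixes \<phi> \<psi>1 \<psi>2 c d f h :: "real \<Rightarrow> real"
  assumes phi: "odd_inc_homeo \<phi>"
    and A: "condA \<phi> \<psi>1 \<psi>2"
    and c: "continuous_on {0..1} c" "\<forall>t\<in>{0..1}. c t > 0"
    and d: "continuous_on {0..1} d" "\<forall>t\<in>{0..1}. d t > 0"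
    and f: "continuous_on {0..} f" "\<forall>s\<ge>0. f s \<ge> 0" "\<forall>s>0. f s > 0"
    and h: "continuous_on {0<..<1} h" "\<forall>t\<in>{0<..<1}. h t \<ge> 0" "\<exists>t\<in>{0<..<1}. h t \<noteq> 0"
    and hint: "(\<lambda>s. inv_into {0..} \<psi>1 (integral {s..1/2} h)) integrable_on {0<..1/2}"
              "(\<lambda>s. inv_into {0..} \<psi>1 (integral {1/2..s} h)) integrable_on {1/2..<1}"
    and gam: "0 \<le> alpha_h h" "alpha_h h < gamma1_h h" "gamma1_h h < gamma2_h h"
             "gamma2_h h < beta_h h" "beta_h h \<le> 1"
    and f0: "filterlim (\<lambda>s. f s / \<phi> s) at_top (at_right 0)"
    and finf: "filterlim (\<lambda>s. f s / \<phi> s) at_top at_top"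
  shows "\<exists>lam_star > 0. \<exists>m_star > 0. \<exists>u1 u2 :: real \<Rightarrow> real \<Rightarrow> real.
           (\<forall>lam\<in>{0<..<lam_star}.
              is_pos_solution \<phi> c d h f lam (u1 lam) \<and> is_pos_solution \<phi> c d h f lam (u2 lam) \<and>
              0 < supnorm (u1 lam) \<and> supnorm (u1 lam) < m_star \<and> m_star < supnorm (u2 lam)) \<and>
           ((\<lambda>lam. supnorm (u1 lam)) \<longlongrightarrow> 0) (at_right 0) \<and>
           filterlim (\<lambda>lam. supnorm (u2 lam)) at_top (at_right 0) \<and>
           (\<exists>u. is_pos_solution \<phi> c d h f lam_star u)"
proof -
  obtain G where hom: "homeomorphism UNIV UNIV \<phi> G" and \<phi>_mono: "strict_mono \<phi>" and \<phi>_odd: "\<And>x. \<phi> (- x) = - \<phi> x"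
    using phi unfolding odd_inc_homeo_def by blast
  have \<phi>_G: "\<phi> (G y) = y" and G_\<phi>: "G (\<phi> y) = y" for y
    using hom by (simp_all add: homeomorphism_def)
  have G_cont: "continuous_on UNIV G" using hom by (simp add: homeomorphism_def)
  have G_mono: "strict_mono G"
    using \<phi>_mono by (metis (no_types) \<phi>_G strict_mono_def strict_mono_less)
  have \<phi>_0: "\<phi> 0 = 0" using \<phi>_odd[of 0] by simp
  have G_0: "G 0 = 0" using G_\<phi>[of 0] \<phi>_0 by simp
  have G_le: "G x \<le> y \<longleftrightarrow> x \<le> \<phi> y" "y \<le> G x \<longleftrightarrow> \<phi> y \<le> x" "G x < y \<longleftrightarrow> x < \<phi> y" for x y
    using strict_mono_less_eq[OF \<phi>_mono] strict_mono_less[OF \<phi>_mono] \<phi>_G by metis+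
  have \<phi>_pos: "0 < \<phi> x" if "0 < x" for x using strict_mono_less[OF \<phi>_mono, of 0 x] \<phi>_0 that by simp
  have G_nonneg: "0 \<le> G y" if "0 \<le> y" for y using G_le(2)[of 0 y] \<phi>_0 that by simp
  have \<psi>1: "inc_homeo_nonneg \<psi>1" and \<psi>2: "inc_homeo_nonneg \<psi>2"
    and A1: "\<And>x y. 0 \<le> x \<Longrightarrow> 0 \<le> y \<Longrightarrow> \<phi> x * \<psi>1 y \<le> \<phi> (x * y)"
    and A2: "\<And>x y. 0 \<le> x \<Longrightarrow> 0 \<le> y \<Longrightarrow> \<phi> (x * y) \<le> \<phi> x * \<psi>2 y"
    using A unfolding condA_def by auto
  have bounds: "\<exists>a b. 0 < a \<and> (\<forall>t\<in>{0..1}. a \<le> e t \<and> e t \<le> b)"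
    if e: "continuous_on {0..1} e" "\<forall>t\<in>{0..1}. e t > 0" for e :: "real \<Rightarrow> real"
  proof -
    obtain s where "s \<in> {0..1}" "\<forall>t\<in>{0..1}. e s \<le> e t"
      using continuous_attains_inf[OF _ _ e(1)] by (auto simp del: atLeastAtMost_iff)
    moreover obtain s' where "s' \<in> {0..1}" "\<forall>t\<in>{0..1}. e t \<le> e s'"
      using continuous_attains_sup[OF _ _ e(1)] by (auto simp del: atLeastAtMost_iff)
    ultimately show ?thesis using e(2) by blast
  qed
  obtain c0 c1 where c01: "0 < c0" "\<And>t. t \<in> {0..1} \<Longrightarrow> c0 \<le> c t \<and> c t \<le> c1"
    using bounds[OF c] by blast
  obtain d0 d1 where d01: "0 < d0" "\<And>t. t \<in> {0..1} \<Longrightarrow> d0 \<le> d t \<and> d t \<le> d1"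
    using bounds[OF d] by blast
  have c1: "0 < c1" and d1: "0 < d1" using c01 d01 by force+
  \<comment> \<open>Chosen so that the factor \<open>\<psi>2 \<kappa>\<close> turns
    \<open>w / d0\<close> into \<open>w / d1\<close> in the right-hand inequality of (A).\<close>
  define \<kappa> where "\<kappa> = inv_into {0..} \<psi>2 (d0 / d1)"
  have \<kappa>: "0 < \<kappa>" "\<psi>2 \<kappa> = d0 / d1"
    unfolding \<kappa>_def using inc_homeo_nonneg_inv[OF \<psi>2, of "d0 / d1"] d01(1) d1 by auto
  have \<kappa>_le: "\<kappa> * G (w / d0) \<le> G (w / d1)" if "0 \<le> w" for w
  proof -
    have "\<phi> (G (w / d0) * \<kappa>) \<le> \<phi> (G (w / d0)) * \<psi>2 \<kappa>"
      by (rule A2) (use that d01(1) \<kappa> G_nonneg in auto)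
    also have "\<dots> = w / d1" using \<kappa> \<phi>_G d01(1) by simp
    finally show ?thesis by (simp add: G_le(2) mult.commute)
  qed
  have G_prod: "G (K * y) \<le> G K * inv_into {0..} \<psi>1 y" if "0 \<le> K" "0 \<le> y" for K y
    using A1[OF G_nonneg[OF that(1)], of "inv_into {0..} \<psi>1 y"] inc_homeo_nonneg_inv[OF \<psi>1 that(2)]
    by (simp add: G_le(1) \<phi>_G)
  define h' where "h' = (\<lambda>t. h (1 - t))"
  have h': "continuous_on {0<..<1} h'" "\<And>t. t \<in> {0<..<1} \<Longrightarrow> 0 \<le> h' t"
    unfolding h'_def using h(2) by (auto intro!: continuous_on_compose2[OF h(1)] continuous_intros)
  have hint': "(\<lambda>s. inv_into {0..} \<psi>1 (integral {s..1/2} h')) integrable_on {0<..1/2}"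
    unfolding h'_def by (rule reflected_half_integrable[OF h(1) hint(2)])
  \<comment> \<open>One constant for both halves; the 1 makes it positive, as it is divided by
    later.\<close>
  define Q where "Q = max 1 (max (integral {0<..1/2} (\<lambda>s. inv_into {0..} \<psi>1 (integral {s..1/2} h)))
    (integral {0<..1/2} (\<lambda>s. inv_into {0..} \<psi>1 (integral {s..1/2} h'))))"
  have Q: "0 < Q" by (simp add: Q_def)
  obtain t0 where t0: "0 < t0" "t0 < 1" "0 < h t0" using h(2,3) by force
  have "isCont h t0" using h(1) t0 by (simp add: continuous_on_eq_continuous_at)
  then have "\<forall>\<^sub>F t in nhds t0. 0 < h t"
    using t0(3) by (intro order_tendstoD(1)[of h "h t0"]) (simp_all add: isCont_def tendsto_at_iff_tendsto_nhds)
  then obtain e where e: "0 < e" "\<And>t. \<bar>t - t0\<bar> < e \<Longrightarrow> 0 < h t"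
    unfolding eventually_nhds_metric dist_real_def by blast
  define \<rho> where "\<rho> = min (e / 2) (min (t0 / 2) ((1 - t0) / 2))"
  have \<rho>: "0 < \<rho>" "\<rho> < e" "\<rho> < t0" "\<rho> < 1 - t0"
    unfolding \<rho>_def using e(1) t0 by (auto simp: min_def)
  interpret left: half_operator G c d h c0 c1 d0 d1 \<kappa> Q
  proof
    show "(\<lambda>s. G (K * integral {s..1/2} h)) integrable_on {0<..1/2}"
      "integral {0<..1/2} (\<lambda>s. G (K * integral {s..1/2} h)) \<le> Q * G K" if "0 \<le> K" for K
      by (rule half_integrability[OF G_cont G_nonneg h(1) _ G_prod hint(1) that, of Q]; use h(2) in \<open>simp add: Q_def\<close>)+
  qed (use G_mono G_cont G_0 c d c01 d01 h \<kappa> \<kappa>_le in auto)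
  interpret right: half_operator G "\<lambda>t. c (1 - t)" "\<lambda>t. d (1 - t)" "\<lambda>t. h (1 - t)" c0 c1 d0 d1 \<kappa> Q
    unfolding h'_def[symmetric]
  proof
    show "(\<lambda>s. G (K * integral {s..1/2} h')) integrable_on {0<..1/2}"
      "integral {0<..1/2} (\<lambda>s. G (K * integral {s..1/2} h')) \<le> Q * G K" if "0 \<le> K" for K
      by (rule half_integrability[OF G_cont G_nonneg h' G_prod hint' that, of Q]; simp add: Q_def)+
    show "continuous_on {0..1} (\<lambda>t. c (1 - t))"
      by (rule continuous_on_compose2[OF c(1)]) (auto intro!: continuous_intros)
    show "continuous_on {0..1} (\<lambda>t. d (1 - t))"
      by (rule continuous_on_compose2[OF d(1)]) (auto intro!: continuous_intros)
  qed (use G_mono G_cont G_0 c01 d01 h' \<kappa> \<kappa>_le in auto)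
  interpret two_sided G c d h c0 c1 d0 d1 \<kappa> Q \<phi> f t0 "t0 - \<rho>" "t0 + \<rho>"
    by standard (use \<phi>_G \<phi>_odd f e \<rho> in auto)
  have "\<exists>F>0. \<forall>s. 0 \<le> s \<longrightarrow> s \<le> r \<longrightarrow> f s \<le> F" for r
  proof -
    obtain F where "0 \<le> F" "\<And>s. 0 \<le> s \<Longrightarrow> s \<le> r \<Longrightarrow> f s \<le> F" using f_bounded[of r] by blast
    then show ?thesis by (intro exI[of _ "F + 1"]) force
  qed
  then obtain F where F: "\<And>r. 0 < F r" "\<And>r s. 0 \<le> s \<Longrightarrow> s \<le> r \<Longrightarrow> f s \<le> F r" by metis
  \<comment> \<open>For \<open>lam = bnd r\<close> the bound
    \<open>Q / c0 * G (lam * F r / d0)\<close> of \<open>matched_upper\<close> equals exactly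
    \<open>r\<close>.\<close>
  define bnd where "bnd r = d0 * \<phi> (r * c0 / Q) / F r" for r
  have bnd: "0 < bnd r" if "0 < r" for r
    unfolding bnd_def using F(1) d01(1) that c01(1) Q by (auto intro!: divide_pos_pos mult_pos_pos \<phi>_pos)
  have upper: "N \<le> r" "lam < bnd r \<Longrightarrow> N < r"
    if "matched lam r u x N" "0 < lam" "lam \<le> bnd r" "0 < r" for lam r u x N
  proof -
    have N: "N \<le> Q / c0 * G (lam * F r / d0)"
      by (rule matched_upper[OF that(1)]) (use that F(1)[of r] F(2)[of _ r] in \<open>auto intro: less_imp_le\<close>)
    have "lam * F r / d0 \<le> \<phi> (r * c0 / Q)"
      using that(3) F(1)[of r] d01(1) by (simp add: bnd_def field_simps)
    then have "G (lam * F r / d0) \<le> r * c0 / Q" by (simp add: G_le)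
    then have "Q / c0 * G (lam * F r / d0) \<le> Q / c0 * (r * c0 / Q)"
      using Q c01(1) by (intro mult_left_mono) auto
    then show "N \<le> r" using N Q c01(1) by simp
    assume "lam < bnd r"
    then have "lam * F r / d0 < \<phi> (r * c0 / Q)"
      using F(1)[of r] d01(1) by (simp add: bnd_def field_simps)
    then have "G (lam * F r / d0) < r * c0 / Q" by (simp add: G_le)
    then have "Q / c0 * G (lam * F r / d0) < Q / c0 * (r * c0 / Q)"
      using Q c01(1) by (intro mult_strict_left_mono) auto
    then show "N < r" using N Q c01(1) by simp
  qed
  \<comment> \<open>With \<open>z = q * \<tau> * r\<close>, condition (A) bounds
    \<open>\<phi> (r * c1 / \<tau>)\<close> by \<open>\<phi> z\<close> times this value of \<psi>2.
    If \<open>f\<close> exceeds \<phi> by the factor \<open>slope lam\<close> on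
    \<open>[z, r]\<close>, the bound of \<open>matched_lower\<close> is therefore at least
    \<open>r\<close>.\<close>
  define slope where "slope lam = d1 * \<psi>2 (c1 / (q * \<tau> * \<tau>)) / (lam * H)" for lam
  have lower: "r \<le> N" if "matched lam r u x N" "0 < lam" "0 < r"
    and fs: "\<And>s. q * \<tau> * r \<le> s \<Longrightarrow> s \<le> r \<Longrightarrow> slope lam * \<phi> s \<le> f s" for lam r u x N
  proof -
    define z where "z = q * \<tau> * r"
    have z: "0 < z" unfolding z_def using q \<tau> that by simp
    have pos: "0 \<le> c1 / (q * \<tau> * \<tau>)" using q \<tau> c1 by simp
    have sl: "0 \<le> slope lam"
      unfolding slope_def using d1 H_pos that(2) inc_homeo_nonneg_ge0[OF \<psi>2 pos] by simp
    have fz: "slope lam * \<phi> z \<le> f s" if "z \<le> s" "s \<le> r" for s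
      using fs[of s] that mult_left_mono[OF _ sl, of "\<phi> z" "\<phi> s"] strict_mono_less_eq[OF \<phi>_mono, of z s]
      by (simp add: z_def)
    have "\<tau> / c1 * G (lam * (slope lam * \<phi> z) * H / d1) \<le> N"
      by (rule matched_lower[OF that(1)]) (use that sl \<phi>_pos[OF z] fz in \<open>auto simp: z_def\<close>)
    moreover have "r * c1 / \<tau> \<le> G (lam * (slope lam * \<phi> z) * H / d1)"
    proof -
      have "r * c1 / \<tau> = z * (c1 / (q * \<tau> * \<tau>))" unfolding z_def using q \<tau> by (simp add: field_simps)
      then have "\<phi> (r * c1 / \<tau>) \<le> \<phi> z * \<psi>2 (c1 / (q * \<tau> * \<tau>))" using A2[OF _ pos, of z] z by simp
      also have "\<dots> = lam * (slope lam * \<phi> z) * H / d1"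
        unfolding slope_def using that(2) H_pos d1 by (simp add: field_simps)
      finally show ?thesis by (simp add: G_le)
    qed
    then have "\<tau> / c1 * (r * c1 / \<tau>) \<le> \<tau> / c1 * G (lam * (slope lam * \<phi> z) * H / d1)"
      using \<tau> c1 by (intro mult_left_mono) auto
    ultimately show "r \<le> N" using \<tau> c1 by simp
  qed
  have f_ge: "slope * \<phi> s \<le> f s" if "slope \<le> f s / \<phi> s" "0 < s" for slope s
    using that \<phi>_pos[of s] by (simp add: le_divide_eq)
  define sol where "sol lam y \<longleftrightarrow> (\<exists>u. is_pos_solution \<phi> c d h f lam u \<and> supnorm u = y)" for lam y
  have small: "\<exists>y. 0 < y \<and> y \<le> r \<and> (lam < bnd r \<longrightarrow> y < r) \<and> sol lam y"
    if lam: "0 < lam" "lam \<le> bnd r" and r: "0 < r" for lam r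
  proof -
    have "\<forall>\<^sub>F s in at_right 0. slope lam \<le> f s / \<phi> s"
      using f0 by (simp add: filterlim_at_top)
    then obtain b where b: "0 < b" "\<And>s. 0 < s \<Longrightarrow> s < b \<Longrightarrow> slope lam \<le> f s / \<phi> s"
      unfolding eventually_at_right_field by auto
    define m where "m = min b r / 2"
    have m: "0 < m" "m < r" "m < b" using b(1) r by (auto simp: m_def)
    obtain u x y where y: "m \<le> y" "y \<le> r" "matched lam y u x y" "is_pos_solution \<phi> c d h f lam u" "supnorm u = y"
    proof (rule solution_in_annulus[OF lam(1) m(1,2), of 1])
      show "0 \<le> 1 * (N - m)" if "matched lam m u x N" for u x N
      proof -
        have "m \<le> N"
        proof (rule lower[OF that lam(1) m(1)])
          fix s assume s: "q * \<tau> * m \<le> s" "s \<le> m"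
          moreover have "0 < q * \<tau> * m" using q \<tau> m by simp
          ultimately show "slope lam * \<phi> s \<le> f s" using b(2)[of s] m by (intro f_ge) auto
        qed
        then show ?thesis by simp
      qed
      show "1 * (N - r) \<le> 0" if "matched lam r u x N" for u x N
        using upper(1)[OF that lam r] by simp
    qed auto
    \<comment> \<open>A solution of norm exactly \<open>r\<close> is matched with
      \<open>N = r\<close>, and the strict upper estimate would give \<open>r < r\<close>.\<close>
    have "y < r" if "lam < bnd r"
      using upper(2)[OF _ lam r that, of u x r] y by (cases "y = r") auto
    then show ?thesis using y m unfolding sol_def by (intro exI[of _ y]) auto
  qed
  have large: "\<exists>y. r \<le> y \<and> (lam < bnd r \<longrightarrow> r < y) \<and> sol lam y"
    if lam: "0 < lam" "lam \<le> bnd r" and r: "0 < r" for lam r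
  proof -
    have "\<forall>\<^sub>F s in at_top. slope lam \<le> f s / \<phi> s"
      using finf by (simp add: filterlim_at_top)
    then obtain b where b: "\<And>s. b \<le> s \<Longrightarrow> slope lam \<le> f s / \<phi> s"
      unfolding eventually_at_top_linorder by auto
    \<comment> \<open>Even the smallest relevant value \<open>q * \<tau> * M\<close> must lie beyond
      \<open>b\<close>, where \<open>f\<close> dominates \<phi>.\<close>
    define M where "M = max (r + 1) (max b 1 / (q * \<tau>))"
    have qt: "0 < q * \<tau>" using q \<tau> by simp
    have M: "r < M" "0 < M" using r by (auto simp: M_def)
    have "max b 1 / (q * \<tau>) \<le> M" by (simp add: M_def)
    then have Mb: "max b 1 \<le> q * \<tau> * M" using qt by (simp add: divide_le_eq mult.commute)
    obtain u x y where y: "r \<le> y" "y \<le> M" "matched lam y u x y" "is_pos_solution \<phi> c d h f lam u" "supnorm u = y"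
    proof (rule solution_in_annulus[OF lam(1) r M(1), of "- 1"])
      show "- 1 * (N - M) \<le> 0" if "matched lam M u x N" for u x N
      proof -
        have "M \<le> N"
        proof (rule lower[OF that lam(1) M(2)])
          fix s assume "q * \<tau> * M \<le> s" "s \<le> M"
          then show "slope lam * \<phi> s \<le> f s" using b[of s] Mb by (intro f_ge) auto
        qed
        then show ?thesis by simp
      qed
      show "0 \<le> - 1 * (N - r)" if "matched lam r u x N" for u x N
        using upper(1)[OF that lam r] by simp
    qed auto
    have "r < y" if "lam < bnd r"
      using upper(2)[OF _ lam r that, of u x r] y by (cases "y = r") auto
    then show ?thesis using y unfolding sol_def by (intro exI[of _ y]) auto
  qed
  define lam_star where "lam_star = bnd 1"
  have lam_star: "0 < lam_star" unfolding lam_star_def by (rule bnd) simp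
  \<comment> \<open>Passing to reciprocals makes norms tending to 0 an instance of the selection of
    diverging values.\<close>
  obtain Y1 where Y1: "\<And>lam. lam \<in> {0<..<lam_star} \<Longrightarrow> 1 < Y1 lam \<and> sol lam (1 / Y1 lam)"
    and lim1: "filterlim Y1 at_top (at_right 0)"
  proof (rule divergent_selection[of lam_star "\<lambda>lam y. sol lam (1 / y)"])
    show "\<exists>y>1. sol lam (1 / y)" if lam: "lam \<in> {0<..<lam_star}" for lam
    proof -
      obtain y where "0 < y" "y < 1" "sol lam y"
        using small[of lam 1] lam unfolding lam_star_def by auto
      then show ?thesis by (intro exI[of _ "1 / y"]) auto
    qed
    show "\<exists>l>0. \<forall>lam\<in>{0<..<l}. \<exists>y\<ge>K. sol lam (1 / y)" if K: "1 < K" for K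
    proof (rule exI[of _ "bnd (1 / K)"], intro conjI ballI)
      show "0 < bnd (1 / K)" by (rule bnd) (use K in simp)
      fix lam assume "lam \<in> {0<..<bnd (1 / K)}"
      then obtain y where "0 < y" "y \<le> 1 / K" "sol lam y" using small[of lam "1 / K"] K by auto
      then show "\<exists>y\<ge>K. sol lam (1 / y)" using K by (intro exI[of _ "1 / y"]) (auto simp: field_simps)
    qed
  qed (use lam_star in auto)
  obtain Y2 where Y2: "\<And>lam. lam \<in> {0<..<lam_star} \<Longrightarrow> 1 < Y2 lam \<and> sol lam (Y2 lam)"
    and lim2: "filterlim Y2 at_top (at_right 0)"
  proof (rule divergent_selection[of lam_star sol])
    show "\<exists>y>1. sol lam y" if "lam \<in> {0<..<lam_star}" for lam
      using large[of lam 1] that unfolding lam_star_def by auto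
    show "\<exists>l>0. \<forall>lam\<in>{0<..<l}. \<exists>y\<ge>K. sol lam y" if K: "1 < K" for K
    proof (rule exI[of _ "bnd K"], intro conjI ballI)
      show "0 < bnd K" by (rule bnd) (use K in simp)
      show "\<exists>y\<ge>K. sol lam y" if "lam \<in> {0<..<bnd K}" for lam
        using large[of lam K] K that by auto
    qed
  qed (use lam_star in auto)
  obtain u1 where u1: "\<And>lam. lam \<in> {0<..<lam_star} \<Longrightarrow>
      is_pos_solution \<phi> c d h f lam (u1 lam) \<and> supnorm (u1 lam) = 1 / Y1 lam"
    using Y1 unfolding sol_def by metis
  obtain u2 where u2: "\<And>lam. lam \<in> {0<..<lam_star} \<Longrightarrow>
      is_pos_solution \<phi> c d h f lam (u2 lam) \<and> supnorm (u2 lam) = Y2 lam"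
    using Y2 unfolding sol_def by metis
  have ev: "\<forall>\<^sub>F lam in at_right 0. lam \<in> {0<..<lam_star}"
    by (rule eventually_at_right_real[OF lam_star])
  have "((\<lambda>lam. 1 / Y1 lam) \<longlongrightarrow> 0) (at_right 0)"
    using tendsto_inverse_0_at_top[OF lim1] by (simp add: inverse_eq_divide)
  then have "((\<lambda>lam. supnorm (u1 lam)) \<longlongrightarrow> 0) (at_right 0)"
    by (rule Lim_transform_eventually) (use ev in eventually_elim, simp add: u1)
  moreover have "filterlim (\<lambda>lam. supnorm (u2 lam)) at_top (at_right 0)"
    using lim2 by (rule filterlim_mono_eventually[OF _ order_refl order_refl])
      (use ev in eventually_elim, simp add: u2)
  moreover have "\<exists>u. is_pos_solution \<phi> c d h f lam_star u"
    using small[of lam_star 1] lam_star unfolding lam_star_def sol_def by auto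
  moreover have "is_pos_solution \<phi> c d h f lam (u1 lam) \<and> is_pos_solution \<phi> c d h f lam (u2 lam) \<and>
      0 < supnorm (u1 lam) \<and> supnorm (u1 lam) < 1 \<and> 1 < supnorm (u2 lam)" if "lam \<in> {0<..<lam_star}" for lam
    using u1[OF that] u2[OF that] Y1[OF that] Y2[OF that] by simp
  ultimately have "\<exists>u1 u2 :: real \<Rightarrow> real \<Rightarrow> real.
           (\<forall>lam\<in>{0<..<lam_star}.
              is_pos_solution \<phi> c d h f lam (u1 lam) \<and> is_pos_solution \<phi> c d h f lam (u2 lam) \<and>
              0 < supnorm (u1 lam) \<and> supnorm (u1 lam) < 1 \<and> 1 < supnorm (u2 lam)) \<and>
           ((\<lambda>lam. supnorm (u1 lam)) \<longlongrightarrow> 0) (at_right 0) \<and>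
           filterlim (\<lambda>lam. supnorm (u2 lam)) at_top (at_right 0) \<and>
           (\<exists>u. is_pos_solution \<phi> c d h f lam_star u)" by blast
  then show ?thesis using lam_star zero_less_one by blast
qed

end
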